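(* Let $m>1$, $0\le u_0\in L^1(\mathbb{R}^N)$, let $-\mathfrak{L}$ be an operator as in the context for which the Green function assumption holds with $A=-\mathfrak{L}$, and let $u$ be a weak dual solution of $\partial_t u+(-\mathfrak{L})[u^m]=0$ with initial data $u_0$. Suppose there are $\alpha\in(0,2)$, $x_0\in\mathbb{R}^N$ and constants $K_1,K_2>0$ (independent of $x_0$) such that $$\int_{B_R(x_0)}\mathbb{G}_{-\mathfrak{L}}^{x_0}(x)\,dx\le K_1R^{\beta}\quad\text{and}\quad \mathbb{G}_{-\mathfrak{L}}^{x_0}(x)\le K_2R^{-(N-\beta)}\ \text{ for a.e. } x\in\mathbb{R}^N\setminus B_R(x_0)$$ holds with $\beta=\alpha$ for all $0<R\le1$ and with $\beta=2$ for all $R>1$. Then $$\|u(\cdot,t)\|_{L^\infty(\mathbb{R}^N)}\le\tilde C(m)\begin{cases}t^{-N\theta_\alpha}\|u_0\|_{L^1(\mathbb{R}^N)}^{\alpha\theta_\alpha}&\text{for a.e. }0<t\le\|u_0\|_{L^1(\mathbb{R}^N)}^{-(m-1)},\\ t^{-N\theta_2}\|u_0\|_{L^1(\mathbb{R}^N)}^{2\theta_2}&\text{for a.e. }t>\|u_0\|_{L^1(\mathbb{R}^N)}^{-(m-1)},\end{cases}$$ where $\theta_\alpha=(\alpha+N(m-1))^{-1}$, $\theta_2=(2+N(m-1))^{-1}$, $C(m):=2^{\frac{m}{m-1}}$ and $$\tilde C(m):=2\Big((C(m)K_1)^{\frac{m}{m-1}}+\frac{m}{m-1}C(m)K_2\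Big)^{\frac1m}.$$
   Context: Throughout $N\ge 3$. Operator. $-\mathfrak{L}$ is a linear, symmetric, nonnegative operator which is densely defined, $\mathfrak m$-accretive and Dirichlet in $L^1(\mathbb{R}^N)$: writing $A=-\mathfrak{L}$ with domain $D(A)\subset L^1(\mathbb{R}^N)$, $D(A)$ is dense in $L^1$; $\|u\|_{L^1}\le\|u+\lambda A[u]\|_{L^1}$ for all $u\in D(A)$, $\lambda>0$; the range of $I+\lambda A$ is $L^1(\mathbb{R}^N)$ for all $\lambda>0$; and if $f\in L^1$, $a\le f\le b$ a.e. ($a,b\in\mathbb{R}$), then $a\le(I+\lambda A)^{-1}f\le b$ a.e. Green function assumption for an operator $A$: there is a function $\mathbb{G}_A^{x_0}\in L^1_{\rm loc}(\mathbb{R}^N)$ (for each $x_0$) with $0\le\mathbb{G}_A^{x_0}=\mathbb{G}_A^0(\cdot-x_0)=\mathbb{G}_A^0(x_0-\cdot)$ a.e. and $A[\mathbb{G}_A^{x_0}]=\delta_{x_0}$ in $\mathcal D'(\mathbb{R}^N)$. Then $A^{-1}[f](y):=\int_{\mathbb{R}^N}\mathbb{G}_A^0(x-y)f(x)\,dx$ whenever the integral converges. Weak dual solution of $\partial_tu+(-\mathfrak{L})[u^m]=0$ in $\mathbb{R}^N\times(0,T)$, $u(\cdot,0)=u_0$: a nonnegative measurable $u$ such that (i) $u\in C([0,T];L^1(\mathbb{R}^N))$ and $u^m\in L^1((0,T);L^1_{\rm loc}(\mathbb{R}^N))$; (ii) for a.e. $0<\tau_1\le\tau_2\le T$ and all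 $\psi\in C^1_{\rm c}([\tau_1,\tau_2];L^\infty_{\rm c}(\mathbb{R}^N))$ (here $L_{\rm c}^\infty$ denotes bounded functions with compact support), $$\int_{\tau_1}^{\tau_2}\!\!\int_{\mathbb{R}^N}\big((-\mathfrak{L})^{-1}[u]\partial_t\psi-u^m\psi\big)dx\,dt=\int_{\mathbb{R}^N}(-\mathfrak{L})^{-1}[u(\cdot,\tau_2)]\psi(\cdot,\tau_2)dx-\int_{\mathbb{R}^N}(-\mathfrak{L})^{-1}[u(\cdot,\tau_1)]\psi(\cdot,\tau_1)dx;$$ (iii) $u(\cdot,0)=u_0$ a.e. Here $u$ is a weak dual solution for every $T>0$. Standing assumption: the comparison principle ($u_0\le v_0$ a.e. implies $u\le v$ a.e.) and $L^p$-decay ($\|u(\cdot,\tau_2)\|_{L^p}\le\|u(\cdot,\tau_1)\|_{L^p}$ for $p\in[1,\infty]$ and a.e. $0\le\tau_1\le\tau_2$) hold for solutions of the equation. *)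

theory Defs
  imports "HOL-Analysis.Analysis" "HOL-Probability.Essential_Supremum"
begin

text \<open>
  \<open>\<real>\<^sup>N\<close> is a type \<open>'a :: euclidean_space\<close> with \<open>N = DIM('a)\<close>.  Elements of \<open>L\<^sup>p\<close> spaces are given by
  Borel representatives, and functions of space and time are written \<open>u t x\<close>, time first.
\<close>

section \<open>Function spaces\<close>

definition Lp_norm :: "ennreal \<Rightarrow> ('a::euclidean_space \<Rightarrow> real) \<Rightarrow> ennreal" where
  "Lp_norm p f =
     (if p = \<infinity> then esssup lborel (\<lambda>x. ennreal \<bar>f x\<bar>)
      else let I = (\<integral>\<^sup>+ x. ennreal (\<bar>f x\<bar> powr enn2real p) \<partial>lborel) in
        if I = \<infinity> then \<infinity> else ennreal (enn2real I powr (1 / enn2real p)))"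

lemma Lp_norm_infinity: "Lp_norm \<infinity> f = esssup lborel (\<lambda>x. ennreal \<bar>f x\<bar>)"
  by (simp add: Lp_norm_def)

lemma Lp_norm_1: "Lp_norm 1 f = (\<integral>\<^sup>+ x. ennreal \<bar>f x\<bar> \<partial>lborel)"
  by (cases "(\<integral>\<^sup>+ x. ennreal \<bar>f x\<bar> \<partial>lborel)")
     (auto simp: Lp_norm_def Let_def)

definition locally_integrable :: "('a::euclidean_space \<Rightarrow> real) \<Rightarrow> bool" where
  "locally_integrable f \<longleftrightarrow> (\<forall>K. compact K \<longrightarrow> set_integrable lborel K f)"

primrec Ck_function :: "nat \<Rightarrow> ('a::euclidean_space \<Rightarrow> real) \<Rightarrow> bool" where
  "Ck_function 0 f \<longleftrightarrow> continuous_on UNIV f"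
| "Ck_function (Suc k) f \<longleftrightarrow>
     (\<exists>f'. (\<forall>x. (f has_derivative f' x) (at x)) \<and> (\<forall>v. Ck_function k (\<lambda>x. f' x v)))"

definition test_function :: "('a::euclidean_space \<Rightarrow> real) \<Rightarrow> bool" where
  "test_function \<phi> \<longleftrightarrow> (\<forall>k. Ck_function k \<phi>) \<and> compact (closure {x. \<phi> x \<noteq> 0})"

definition continuous_into_L1 :: "real \<Rightarrow> (real \<Rightarrow> 'a::euclidean_space \<Rightarrow> real) \<Rightarrow> bool" where
  "continuous_into_L1 T u \<longleftrightarrow>
     (\<forall>t\<in>{0..T}. integrable lborel (u t) \<and>
        ((\<lambda>s. Lp_norm 1 (\<lambda>x. u s x - u t x)) \<longlongrightarrow> 0) (at t within {0..T}))"

text \<open>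
  \<open>\<psi> \<in> C\<^sup>1\<^sub>c([\<tau>1,\<tau>2]; L\<^sup>\<infinity>\<^sub>c)\<close> with time derivative \<open>\<psi>'\<close>: differentiability in time and continuity of the
  derivative are with respect to the \<open>L\<^sup>\<infinity>\<close> norm, and one compact set carries \<open>\<psi> t\<close> for all \<open>t\<close>.
  For \<open>\<tau>1 < \<tau>2\<close>, \<open>\<psi>'\<close> is determined by \<open>\<psi>\<close> up to null sets.
\<close>

definition C1_Linf_test ::
  "real \<Rightarrow> real \<Rightarrow> (real \<Rightarrow> 'a::euclidean_space \<Rightarrow> real) \<Rightarrow> (real \<Rightarrow> 'a \<Rightarrow> real) \<Rightarrow> bool" where
  "C1_Linf_test \<tau>1 \<tau>2 \<psi> \<psi>' \<longleftrightarrow>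
     set_borel_measurable borel ({\<tau>1..\<tau>2} \<times> UNIV) (\<lambda>(t, x). \<psi> t x) \<and>
     set_borel_measurable borel ({\<tau>1..\<tau>2} \<times> UNIV) (\<lambda>(t, x). \<psi>' t x) \<and>
     (\<forall>t\<in>{\<tau>1..\<tau>2}. Lp_norm \<infinity> (\<psi> t) < \<infinity> \<and> Lp_norm \<infinity> (\<psi>' t) < \<infinity>) \<and>
     (\<exists>K. compact K \<and> (\<forall>t\<in>{\<tau>1..\<tau>2}. AE x in lborel. x \<notin> K \<longrightarrow> \<psi> t x = 0)) \<and>
     (\<forall>t\<in>{\<tau>1..\<tau>2}.
        ((\<lambda>s. Lp_norm \<infinity> (\<lambda>x. (\<psi> s x - \<psi> t x) / (s - t) - \<psi>' t x)) \<longlongrightarrow> 0)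
          (at t within {\<tau>1..\<tau>2}) \<and>
        ((\<lambda>s. Lp_norm \<infinity> (\<lambda>x. \<psi>' s x - \<psi>' t x)) \<longlongrightarrow> 0) (at t within {\<tau>1..\<tau>2}))"

section \<open>Operators in \<open>L\<^sup>1\<close>\<close>

text \<open>
  An operator \<open>A : D(A) \<subseteq> L\<^sup>1 \<rightarrow> L\<^sup>1\<close> is a set \<open>D\<close> of representatives, saturated under a.e. equality,
  with a map \<open>A\<close> that respects a.e. equality on \<open>D\<close>.
\<close>

definition linear_L1_operator ::
  "('a::euclidean_space \<Rightarrow> real) set \<Rightarrow> (('a \<Rightarrow> real) \<Rightarrow> ('a \<Rightarrow> real)) \<Rightarrow> bool" where
  "linear_L1_operator D A \<longleftrightarrow>
     (\<forall>f\<in>D. integrable lborel f \<and> integrable lborel (A f)) \<and>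
     (\<forall>f\<in>D. \<forall>g. integrable lborel g \<and> (AE x in lborel. g x = f x) \<longrightarrow>
        g \<in> D \<and> (AE x in lborel. A g x = A f x)) \<and>
     (\<lambda>x. 0) \<in> D \<and>
     (\<forall>f\<in>D. \<forall>g\<in>D. \<forall>a b. (\<lambda>x. a * f x + b * g x) \<in> D \<and>
        (AE x in lborel. A (\<lambda>x. a * f x + b * g x) x = a * A f x + b * A g x))"

text \<open>
  For \<open>f, g \<in> D(A)\<close> the product \<open>A[f] g\<close> need not be integrable; symmetry and nonnegativity are
  statements about \<open>D(A) \<inter> L\<^sup>\<infinity>\<close>, where it is.
\<close>

definition symmetric_operator ::
  "('a::euclidean_space \<Rightarrow> real) set \<Rightarrow> (('a \<Rightarrow> real) \<Rightarrow> ('a \<Rightarrow> real)) \<Rightarrow> bool" where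
  "symmetric_operator D A \<longleftrightarrow>
     (\<forall>f\<in>D. \<forall>g\<in>D. Lp_norm \<infinity> f < \<infinity> \<and> Lp_norm \<infinity> g < \<infinity> \<longrightarrow>
        (LINT x|lborel. A f x * g x) = (LINT x|lborel. f x * A g x))"

definition nonnegative_operator ::
  "('a::euclidean_space \<Rightarrow> real) set \<Rightarrow> (('a \<Rightarrow> real) \<Rightarrow> ('a \<Rightarrow> real)) \<Rightarrow> bool" where
  "nonnegative_operator D A \<longleftrightarrow>
     (\<forall>f\<in>D. Lp_norm \<infinity> f < \<infinity> \<longrightarrow> 0 \<le> (LINT x|lborel. A f x * f x))"

definition densely_defined ::
  "('a::euclidean_space \<Rightarrow> real) set \<Rightarrow> bool" where
  "densely_defined D \<longleftrightarrow>
     (\<forall>f. integrable lborel f \<longrightarrow>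
        (\<forall>\<epsilon>>0. \<exists>g\<in>D. Lp_norm 1 (\<lambda>x. f x - g x) < ennreal \<epsilon>))"

definition m_accretive ::
  "('a::euclidean_space \<Rightarrow> real) set \<Rightarrow> (('a \<Rightarrow> real) \<Rightarrow> ('a \<Rightarrow> real)) \<Rightarrow> bool" where
  "m_accretive D A \<longleftrightarrow>
     (\<forall>r>0. \<forall>f\<in>D. Lp_norm 1 f \<le> Lp_norm 1 (\<lambda>x. f x + r * A f x)) \<and>
     (\<forall>r>0. \<forall>f. integrable lborel f \<longrightarrow>
        (\<exists>g\<in>D. AE x in lborel. g x + r * A g x = f x))"

text \<open>Here \<open>g\<close> is \<open>(I + rA)\<^sup>-\<^sup>1 f\<close>, which is unique up to null sets when \<open>A\<close> is accretive.\<close>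

definition dirichlet_operator ::
  "('a::euclidean_space \<Rightarrow> real) set \<Rightarrow> (('a \<Rightarrow> real) \<Rightarrow> ('a \<Rightarrow> real)) \<Rightarrow> bool" where
  "dirichlet_operator D A \<longleftrightarrow>
     (\<forall>r>0. \<forall>f g a b. integrable lborel f \<and> (AE x in lborel. a \<le> f x \<and> f x \<le> b) \<and>
        g \<in> D \<and> (AE x in lborel. g x + r * A g x = f x) \<longrightarrow>
        (AE x in lborel. a \<le> g x \<and> g x \<le> b))"

definition diffusion_operator ::
  "('a::euclidean_space \<Rightarrow> real) set \<Rightarrow> (('a \<Rightarrow> real) \<Rightarrow> ('a \<Rightarrow> real)) \<Rightarrow> bool" where
  "diffusion_operator D A \<longleftrightarrow>
     linear_L1_operator D A \<and> symmetric_operator D A \<and> nonnegative_operator D A \<and>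
     densely_defined D \<and> m_accretive D A \<and> dirichlet_operator D A"

section \<open>Green functions\<close>

text \<open>
  \<open>G y\<close> is the Green function with pole \<open>y\<close>.  As \<open>A\<close> is symmetric, \<open>A[G y] = \<delta>\<^sub>y\<close> in \<open>\<D>'\<close> means
  \<open>\<integral> G y \<cdot> A[\<phi>] = \<phi>(y)\<close> for all test functions \<open>\<phi>\<close>; this includes that \<open>A[\<phi>]\<close> is defined and that
  the integral converges.
\<close>

definition green_function ::
  "('a::euclidean_space \<Rightarrow> real) set \<Rightarrow> (('a \<Rightarrow> real) \<Rightarrow> ('a \<Rightarrow> real)) \<Rightarrow> ('a \<Rightarrow> 'a \<Rightarrow> real) \<Rightarrow> bool" where
  "green_function D A G \<longleftrightarrow>
     (\<forall>y. locally_integrable (G y) \<and>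
        (AE x in lborel. 0 \<le> G y x \<and> G y x = G 0 (x - y) \<and> G y x = G 0 (y - x)) \<and>
        (\<forall>\<phi>. test_function \<phi> \<longrightarrow> \<phi> \<in> D \<and> integrable lborel (\<lambda>x. G y x * A \<phi> x) \<and>
           (LINT x|lborel. G y x * A \<phi> x) = \<phi> y))"

definition inverse_op ::
  "('a::euclidean_space \<Rightarrow> 'a \<Rightarrow> real) \<Rightarrow> ('a \<Rightarrow> real) \<Rightarrow> 'a \<Rightarrow> real" where
  "inverse_op G f y = (LINT x|lborel. G 0 (x - y) * f x)"

definition inverse_op_converges ::
  "('a::euclidean_space \<Rightarrow> 'a \<Rightarrow> real) \<Rightarrow> ('a \<Rightarrow> real) \<Rightarrow> bool" where
  "inverse_op_converges G f \<longleftrightarrow>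
     (AE y in lborel. integrable lborel (\<lambda>x. G 0 (x - y) * f x))"

definition green_bounds ::
  "('a::euclidean_space \<Rightarrow> 'a \<Rightarrow> real) \<Rightarrow> 'a \<Rightarrow> real \<Rightarrow> real \<Rightarrow> real \<Rightarrow> real \<Rightarrow> bool" where
  "green_bounds G x0 K1 K2 \<beta> R \<longleftrightarrow>
     (LINT x:ball x0 R|lborel. G x0 x) \<le> K1 * R powr \<beta> \<and>
     (AE x in lborel. x \<notin> ball x0 R \<longrightarrow> G x0 x \<le> K2 * R powr (- (real DIM('a) - \<beta>)))"

section \<open>Weak dual solutions\<close>

text \<open>
  The integral identity includes the convergence of the integrals in it.  The equation
  \<open>\<partial>\<^sub>t u + A[u\<^sup>m] = 0\<close> enters in its dual form, through \<open>A\<^sup>-\<^sup>1\<close>, i.e. through the Green function.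
\<close>

definition weak_dual_solution_on ::
  "real \<Rightarrow> ('a::euclidean_space \<Rightarrow> 'a \<Rightarrow> real) \<Rightarrow> real \<Rightarrow> ('a \<Rightarrow> real) \<Rightarrow> (real \<Rightarrow> 'a \<Rightarrow> real) \<Rightarrow> bool" where
  "weak_dual_solution_on T G m u0 u \<longleftrightarrow>
     (\<forall>t\<in>{0..T}. \<forall>x. 0 \<le> u t x) \<and>
     set_borel_measurable borel ({0<..<T} \<times> UNIV) (\<lambda>(t, x). u t x) \<and>
     continuous_into_L1 T u \<and>
     (\<forall>K. compact K \<longrightarrow> set_integrable lborel ({0<..<T} \<times> K) (\<lambda>(t, x). u t x powr m)) \<and>
     (AE t in lborel. 0 < t \<and> t < T \<longrightarrow> inverse_op_converges G (u t)) \<and>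
     (AE (\<tau>1, \<tau>2) in lborel. 0 < \<tau>1 \<and> \<tau>1 \<le> \<tau>2 \<and> \<tau>2 \<le> T \<longrightarrow>
        (\<forall>\<psi> \<psi>'. C1_Linf_test \<tau>1 \<tau>2 \<psi> \<psi>' \<longrightarrow>
           set_integrable lborel ({\<tau>1..\<tau>2} \<times> UNIV)
             (\<lambda>(t, x). inverse_op G (u t) x * \<psi>' t x - u t x powr m * \<psi> t x) \<and>
           integrable lborel (\<lambda>x. inverse_op G (u \<tau>2) x * \<psi> \<tau>2 x) \<and>
           integrable lborel (\<lambda>x. inverse_op G (u \<tau>1) x * \<psi> \<tau>1 x) \<and>
           (LINT t:{\<tau>1..\<tau>2}|lborel. LINT x|lborel.
               inverse_op G (u t) x * \<psi>' t x - u t x powr m * \<psi> t x) =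
             (LINT x|lborel. inverse_op G (u \<tau>2) x * \<psi> \<tau>2 x) -
             (LINT x|lborel. inverse_op G (u \<tau>1) x * \<psi> \<tau>1 x))) \<and>
     (AE x in lborel. u 0 x = u0 x)"

definition weak_dual_solution ::
  "('a::euclidean_space \<Rightarrow> 'a \<Rightarrow> real) \<Rightarrow> real \<Rightarrow> ('a \<Rightarrow> real) \<Rightarrow> (real \<Rightarrow> 'a \<Rightarrow> real) \<Rightarrow> bool" where
  "weak_dual_solution G m u0 u \<longleftrightarrow> (\<forall>T>0. weak_dual_solution_on T G m u0 u)"

definition comparison_principle ::
  "('a::euclidean_space \<Rightarrow> 'a \<Rightarrow> real) \<Rightarrow> real \<Rightarrow> bool" where
  "comparison_principle G m \<longleftrightarrow>
     (\<forall>u v u0 v0. integrable lborel u0 \<and> integrable lborel v0 \<and>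
        weak_dual_solution G m u0 u \<and> weak_dual_solution G m v0 v \<and>
        (AE x in lborel. u0 x \<le> v0 x) \<longrightarrow>
        (AE (t, x) in lborel. 0 < t \<longrightarrow> u t x \<le> v t x))"

definition Lp_decay ::
  "('a::euclidean_space \<Rightarrow> 'a \<Rightarrow> real) \<Rightarrow> real \<Rightarrow> bool" where
  "Lp_decay G m \<longleftrightarrow>
     (\<forall>u u0 p. integrable lborel u0 \<and> weak_dual_solution G m u0 u \<and> 1 \<le> p \<longrightarrow>
        (AE (\<tau>1, \<tau>2) in lborel. 0 \<le> \<tau>1 \<and> \<tau>1 \<le> \<tau>2 \<longrightarrow>
           Lp_norm p (u \<tau>2) \<le> Lp_norm p (u \<tau>1)))"

section \<open>Constants\<close>

definition C_const :: "real \<Rightarrow> real" where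
  "C_const m = 2 powr (m / (m - 1))"

definition C_tilde :: "real \<Rightarrow> real \<Rightarrow> real \<Rightarrow> real" where
  "C_tilde m K1 K2 =
     2 * ((C_const m * K1) powr (m / (m - 1)) + m / (m - 1) * C_const m * K2) powr (1 / m)"

end

theory Submission
  imports Defs
begin

text \<open>
  Two facts about \<open>u\<close> lead to the bound.  The first is time monotonicity: for \<open>\<lambda> \<ge> 1\<close> the function
  \<open>\<lambda>\<^bsup>1/(m-1)\<^esup> u(\<lambda>t)\<close> is again a weak dual solution, with data \<open>\<lambda>\<^bsup>1/(m-1)\<^esup> u\<^sub>0 \<ge> u\<^sub>0\<close>, so by comparison
  \<open>t \<mapsto> t\<^bsup>1/(m-1)\<^esup> u(t)\<close> is nondecreasing (\<open>weak_dual_solution_monotone\<close>).  The second comes from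
  the dual identity on \<open>[t, 2t]\<close>, tested with indicator functions that do not depend on time:
  \<open>\<integral>\<^sub>t\<^bsup>2t\<^esup> u(s)\<^sup>m ds \<le> (-L)\<^bsup>-1\<^esup>[u(t)]\<close>.  Together they bound \<open>u\<close> by its own potential at the same time,
  \<open>u(t)\<^sup>m \<le> 2\<^bsup>m/(m-1)\<^esup> t\<^bsup>-1\<^esup> (-L)\<^bsup>-1\<^esup>[u(t)]\<close>
  (\<open>weak_dual_solution_powr_le_inverse_op\<close>).

  What is left is a fact about a single function \<open>f = u(t)\<close> of mass at most \<open>M = \<parallel>u\<^sub>0\<parallel>\<^sub>1\<close>.  Splitting
  the Green function at radius \<open>R\<close> gives, with \<open>C = 2\<^bsup>m/(m-1)\<^esup>\<close>,
  \<open>\<parallel>f\<parallel>\<^sub>\<infinity>\<^sup>m \<le> C t\<^bsup>-1\<^esup> (K\<^sub>1 R\<^sup>\<beta> \<parallel>f\<parallel>\<^sub>\<infinity> + K\<^sub>2 R\<^bsup>-(N-\<beta>)\<^esup> M)\<close>; Young's inequality absorbs \<open>\<parallel>f\<parallel>\<^sub>\<infinity>\<close>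
  (\<open>kernel_split.sup_le_of_powr_le_conv\<close>), and \<open>R = (t M\<^bsup>m-1\<^esup>)\<^sup>\<theta>\<close> balances the two terms
  (\<open>optimal_radius\<close>).  This radius is at most \<open>1\<close> exactly when \<open>t \<le> M\<^bsup>-(m-1)\<^esup>\<close>, which decides whether
  \<open>\<beta> = \<alpha>\<close> or \<open>\<beta> = 2\<close> applies.

  Absorption needs \<open>\<parallel>f\<parallel>\<^sub>\<infinity> < \<infinity>\<close>, and the data are only integrable.  No approximation by bounded data
  is used: the inequality \<open>f\<^sup>m \<le> k * f + const\<close> with an integrable kernel \<open>k\<close> and an integrable
  \<open>f\<close> already forces \<open>f\<close> to be bounded (\<open>kernel_split.bounded_of_powr_le_conv\<close>).  The
  argument gives the bound with constant \<open>C_tilde m K1 K2 / 2\<close>.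
\<close>

section \<open>Linear changes of the time variable\<close>

lemma measurable_scale_fst:
  "(\<lambda>p. (c * fst p, snd p)) \<in> borel_measurable (borel :: (real \<times> 'a::euclidean_space) measure)"
  by (intro borel_measurable_continuous_onI continuous_intros)

lemma lborel_scale_fst:
  fixes c :: real
  assumes "c > 0"
  shows "density (distr lborel borel (\<lambda>p. (c * fst p, snd p))) (\<lambda>_. ennreal c) =
    (lborel :: (real \<times> 'a::euclidean_space) measure)"
proof -
  define D where "D = distr lborel borel ((*) c)"
  have D: "density D (\<lambda>_. ennreal c) = lborel"
    using lborel_distr_mult'[of c] assms by (simp add: D_def)
  have "lborel = density D (\<lambda>_. ennreal c) \<Otimes>\<^sub>M density (lborel :: 'a measure) (\<lambda>_. 1)"
    by (simp add: D density_1 lborel_prod)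
  also have "\<dots> = density (D \<Otimes>\<^sub>M lborel) (\<lambda>_. ennreal c)"
    by (subst pair_measure_density)
       (auto simp: density_1 lborel.sigma_finite_measure_axioms case_prod_beta D_def
         intro!: arg_cong2[where f = density])
  also have "D \<Otimes>\<^sub>M (lborel :: 'a measure) = distr lborel borel ((*) c) \<Otimes>\<^sub>M distr lborel borel id"
    by (simp add: D_def id_def distr_id2)
  also have "\<dots> = distr (lborel \<Otimes>\<^sub>M lborel) (borel \<Otimes>\<^sub>M borel) (\<lambda>(x, y). (c * x, id y))"
    by (rule pair_measure_distr) (auto simp: id_def distr_id2 lborel.sigma_finite_measure_axioms)
  also have "\<dots> = distr lborel borel (\<lambda>p. (c * fst p, snd p))"
    by (simp add: lborel_prod borel_prod case_prod_beta')
  finally show ?thesis by simp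
qed

lemma integrable_scale_fst:
  fixes f :: "real \<times> 'a::euclidean_space \<Rightarrow> real"
  assumes "c > 0" "integrable lborel f"
  shows "integrable lborel (\<lambda>p. f (c * fst p, snd p))"
proof -
  have f[measurable]: "f \<in> borel_measurable borel"
    using assms(2) by auto
  have "integrable (density (distr lborel borel (\<lambda>p. (c * fst p, snd p))) (\<lambda>_. ennreal c)) f"
    unfolding lborel_scale_fst[OF assms(1)] by (rule assms(2))
  then have "integrable (distr lborel borel (\<lambda>p. (c * fst p, snd p))) f"
    using assms(1) by (subst (asm) integrable_density) auto
  then show ?thesis
    by (subst (asm) integrable_distr_eq) (auto simp: measurable_scale_fst)
qed

lemma AE_lborel_scaleR:
  fixes P :: "'a::euclidean_space \<Rightarrow> bool"
  assumes "c > 0" "AE x in lborel. P x"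
  shows "AE x in lborel. P (c *\<^sub>R x)"
proof -
  have "AE x in density (distr lborel borel (\<lambda>x. 0 + c *\<^sub>R x)) (\<lambda>_. \<bar>c\<bar>^DIM('a)). P x"
    using assms by (subst lborel_affine[symmetric]) auto
  then have "AE x in distr lborel borel (\<lambda>x. 0 + c *\<^sub>R x). P x"
    using assms by (subst (asm) AE_density) auto
  then have "AE x in lborel. P (0 + c *\<^sub>R x)"
    by (rule AE_distrD[rotated]) auto
  then show ?thesis by simp
qed

lemma filterlim_scale_at_within_Icc:
  fixes k :: real
  assumes "k > 0"
  shows "filterlim (\<lambda>s. k * s) (at (k * t) within {k * a..k * b}) (at t within {a..b})"
  unfolding filterlim_at
proof
  show "\<forall>\<^sub>F s in at t within {a..b}. k * s \<in> {k * a..k * b} \<and> k * s \<noteq> k * t"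
    using assms by (auto simp: eventually_at_filter)
qed (auto intro!: tendsto_intros)

section \<open>Norms\<close>

lemma Lp_norm_infinity_cmult_le:
  assumes "c \<noteq> 0"
  shows "Lp_norm \<infinity> (\<lambda>x. c * f x) \<le> ennreal \<bar>c\<bar> * Lp_norm \<infinity> f"
proof (cases "(\<lambda>x. ennreal \<bar>f x\<bar>) \<in> borel_measurable lborel")
  case True
  have "AE x in lborel. ennreal \<bar>c * f x\<bar> \<le> ennreal \<bar>c\<bar> * esssup lborel (\<lambda>x. ennreal \<bar>f x\<bar>)"
    using esssup_AE[of "\<lambda>x. ennreal \<bar>f x\<bar>" lborel]
    by eventually_elim (simp add: abs_mult ennreal_mult mult_left_mono)
  moreover have "(\<lambda>x. ennreal \<bar>c * f x\<bar>) \<in> borel_measurable lborel"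
    using True by (simp add: abs_mult ennreal_mult)
  ultimately show ?thesis
    unfolding Lp_norm_infinity by (intro esssup_I)
next
  case False
  then have "esssup lborel (\<lambda>x. ennreal \<bar>f x\<bar>) = top"
    by (rule esssup_non_measurable)
  with assms show ?thesis
    unfolding Lp_norm_infinity by (simp add: ennreal_mult_top)
qed

lemma Lp_norm_1_cmult:
  assumes "f \<in> borel_measurable lborel"
  shows "Lp_norm 1 (\<lambda>x. c * f x) = ennreal \<bar>c\<bar> * Lp_norm 1 f"
  unfolding Lp_norm_1 using assms
  by (subst nn_integral_cmult[symmetric]) (auto simp: abs_mult ennreal_mult)

lemma tendsto_0_ennreal_cmult_le:
  fixes f g :: "'b \<Rightarrow> ennreal"
  assumes "(g \<longlongrightarrow> 0) F" "\<And>x. f x \<le> ennreal c * g x"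
  shows "(f \<longlongrightarrow> 0) F"
proof (rule tendsto_sandwich[of "\<lambda>_. 0"])
  show "((\<lambda>x. ennreal c * g x) \<longlongrightarrow> 0) F"
    using ennreal_tendsto_cmult[of "ennreal c" g 0 F] assms by simp
qed (use assms in auto)

section \<open>Time scaling of weak dual solutions\<close>

lemma set_borel_measurable_scale_fst:
  fixes f :: "real \<Rightarrow> 'a::euclidean_space \<Rightarrow> real"
  assumes "set_borel_measurable borel (S \<times> UNIV) (\<lambda>(t, x). f t x)"
    and "\<And>t. k * t \<in> S \<longleftrightarrow> t \<in> S'"
  shows "set_borel_measurable borel (S' \<times> UNIV) (\<lambda>(t, x). c * f (k * t) x)"
proof -
  have "(\<lambda>p. indicator (S \<times> UNIV) p *\<^sub>R (case p of (t, x) \<Rightarrow> f t x)) \<in> borel_measurable borel"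
    using assms(1) by (simp add: set_borel_measurable_def)
  from measurable_compose[OF measurable_scale_fst[of k] this]
  have "(\<lambda>p. indicator (S \<times> UNIV) (k * fst p, snd p) * f (k * fst p) (snd p)) \<in> borel_measurable borel"
    by simp
  then have "(\<lambda>p. c * (indicator (S \<times> UNIV) (k * fst p, snd p) * f (k * fst p) (snd p)))
    \<in> borel_measurable borel"
    by (rule borel_measurable_times[OF borel_measurable_const])
  also have "(\<lambda>p. c * (indicator (S \<times> UNIV) (k * fst p, snd p) * f (k * fst p) (snd p))) =
      (\<lambda>p. indicator (S' \<times> UNIV) p *\<^sub>R (case p of (t, x) \<Rightarrow> c * f (k * t) x))"
    using assms(2) by (auto simp: fun_eq_iff indicator_def)
  finally show ?thesis
    by (simp add: set_borel_measurable_def)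
qed

lemma C1_Linf_test_scale:
  assumes "C1_Linf_test (k * a) (k * b) \<psi> \<psi>'" "k > 0"
  shows "C1_Linf_test a b (\<lambda>t. \<psi> (k * t)) (\<lambda>t x. k * \<psi>' (k * t) x)"
proof -
  have mem: "k * t \<in> {k * a..k * b} \<longleftrightarrow> t \<in> {a..b}" for t
    using assms(2) by auto
  note T = assms(1)[unfolded C1_Linf_test_def]
  have "set_borel_measurable borel ({a..b} \<times> UNIV) (\<lambda>(t, x). 1 * \<psi> (k * t) x)"
    using T by (intro set_borel_measurable_scale_fst[OF _ mem]) blast
  moreover have "set_borel_measurable borel ({a..b} \<times> UNIV) (\<lambda>(t, x). k * \<psi>' (k * t) x)"
    using T by (intro set_borel_measurable_scale_fst[OF _ mem]) blast
  moreover have "Lp_norm \<infinity> (\<psi> (k * t)) < \<infinity>" "Lp_norm \<infinity> (\<lambda>x. k * \<psi>' (k * t) x) < \<infinity>"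
    if "t \<in> {a..b}" for t
  proof -
    have *: "Lp_norm \<infinity> (\<psi> (k * t)) < \<infinity>" "Lp_norm \<infinity> (\<psi>' (k * t)) < \<infinity>"
      using T that mem by blast+
    then show "Lp_norm \<infinity> (\<psi> (k * t)) < \<infinity>" by simp
    have "Lp_norm \<infinity> (\<lambda>x. k * \<psi>' (k * t) x) \<le> ennreal \<bar>k\<bar> * Lp_norm \<infinity> (\<psi>' (k * t))"
      using assms(2) by (intro Lp_norm_infinity_cmult_le) auto
    also have "\<dots> < \<infinity>"
      using *(2) by (simp add: ennreal_mult_less_top)
    finally show "Lp_norm \<infinity> (\<lambda>x. k * \<psi>' (k * t) x) < \<infinity>" .
  qed
  moreover have "\<exists>K. compact K \<and> (\<forall>t\<in>{a..b}. AE x in lborel. x \<notin> K \<longrightarrow> \<psi> (k * t) x = 0)"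
  proof -
    obtain K where "compact K" "\<forall>t\<in>{k * a..k * b}. AE x in lborel. x \<notin> K \<longrightarrow> \<psi> t x = 0"
      using T by blast
    then show ?thesis
      using mem by blast
  qed
  moreover have
    "((\<lambda>s. Lp_norm \<infinity> (\<lambda>x. (\<psi> (k * s) x - \<psi> (k * t) x) / (s - t) - k * \<psi>' (k * t) x)) \<longlongrightarrow> 0)
       (at t within {a..b})"
    "((\<lambda>s. Lp_norm \<infinity> (\<lambda>x. k * \<psi>' (k * s) x - k * \<psi>' (k * t) x)) \<longlongrightarrow> 0)
       (at t within {a..b})"
    if "t \<in> {a..b}" for t
  proof -
    have *: "((\<lambda>s. Lp_norm \<infinity> (\<lambda>x. (\<psi> s x - \<psi> (k * t) x) / (s - k * t) - \<psi>' (k * t) x)) \<longlongrightarrow> 0)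
        (at (k * t) within {k * a..k * b})"
      "((\<lambda>s. Lp_norm \<infinity> (\<lambda>x. \<psi>' s x - \<psi>' (k * t) x)) \<longlongrightarrow> 0) (at (k * t) within {k * a..k * b})"
      using T that mem by blast+
    note ** = *[THEN filterlim_compose, OF filterlim_scale_at_within_Icc[OF assms(2)]]
    have eq: "(\<psi> (k * s) x - \<psi> (k * t) x) / (s - t) - k * \<psi>' (k * t) x =
        k * ((\<psi> (k * s) x - \<psi> (k * t) x) / (k * s - k * t) - \<psi>' (k * t) x)" for s x
      using assms(2) by (cases "s = t") (auto simp: field_simps)
    have k: "k \<noteq> 0" using assms(2) by simp
    show "((\<lambda>s. Lp_norm \<infinity> (\<lambda>x. (\<psi> (k * s) x - \<psi> (k * t) x) / (s - t) - k * \<psi>' (k * t) x))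
        \<longlongrightarrow> 0) (at t within {a..b})"
      unfolding eq by (rule tendsto_0_ennreal_cmult_le[OF **(1)]) (rule Lp_norm_infinity_cmult_le[OF k])
    show "((\<lambda>s. Lp_norm \<infinity> (\<lambda>x. k * \<psi>' (k * s) x - k * \<psi>' (k * t) x)) \<longlongrightarrow> 0)
        (at t within {a..b})"
      unfolding right_diff_distrib[symmetric]
      by (rule tendsto_0_ennreal_cmult_le[OF **(2)]) (rule Lp_norm_infinity_cmult_le[OF k])
  qed
  ultimately show ?thesis
    unfolding C1_Linf_test_def by auto
qed

lemma inverse_op_cmult: "inverse_op G (\<lambda>x. c * f x) y = c * inverse_op G f y"
  unfolding inverse_op_def
  by (subst integral_mult_right_zero[symmetric]) (simp add: ac_simps)

text \<open>
  The integral identity of a weak dual solution on \<open>[\<tau>1,\<tau>2]\<close> for one test function, with the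
  convergence of its integrals.
\<close>

definition dual_identity ::
  "('a::euclidean_space \<Rightarrow> 'a \<Rightarrow> real) \<Rightarrow> real \<Rightarrow> (real \<Rightarrow> 'a \<Rightarrow> real) \<Rightarrow> real \<Rightarrow> real \<Rightarrow>
    (real \<Rightarrow> 'a \<Rightarrow> real) \<Rightarrow> (real \<Rightarrow> 'a \<Rightarrow> real) \<Rightarrow> bool" where
  "dual_identity G m u \<tau>1 \<tau>2 \<psi> \<psi>' \<longleftrightarrow>
     set_integrable lborel ({\<tau>1..\<tau>2} \<times> UNIV)
       (\<lambda>(t, x). inverse_op G (u t) x * \<psi>' t x - u t x powr m * \<psi> t x) \<and>
     integrable lborel (\<lambda>x. inverse_op G (u \<tau>2) x * \<psi> \<tau>2 x) \<and>
     integrable lborel (\<lambda>x. inverse_op G (u \<tau>1) x * \<psi> \<tau>1 x) \<and>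
     (LINT t:{\<tau>1..\<tau>2}|lborel. LINT x|lborel.
         inverse_op G (u t) x * \<psi>' t x - u t x powr m * \<psi> t x) =
       (LINT x|lborel. inverse_op G (u \<tau>2) x * \<psi> \<tau>2 x) -
       (LINT x|lborel. inverse_op G (u \<tau>1) x * \<psi> \<tau>1 x)"

lemma weak_dual_solution_on_dual_identity:
  assumes "weak_dual_solution_on T G m u0 u"
  shows "AE (\<tau>1, \<tau>2) in lborel. 0 < \<tau>1 \<and> \<tau>1 \<le> \<tau>2 \<and> \<tau>2 \<le> T \<longrightarrow>
    (\<forall>\<psi> \<psi>'. C1_Linf_test \<tau>1 \<tau>2 \<psi> \<psi>' \<longrightarrow> dual_identity G m u \<tau>1 \<tau>2 \<psi> \<psi>')"
  using assms unfolding weak_dual_solution_on_def dual_identity_def by blast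

text \<open>
  With \<open>c = l\<^bsup>1/(m-1)\<^esup>\<close> one has \<open>c\<^sup>m = c l\<close>, and the factor \<open>l\<close> is the one that the substitution
  \<open>s = l t\<close> produces in the time derivative of the test function.
\<close>

lemma weak_dual_solution_on_scale:
  fixes u :: "real \<Rightarrow> 'a::euclidean_space \<Rightarrow> real"
  assumes sol: "weak_dual_solution_on (l * T) G m u0 u" and l: "l > 0" and m: "m > 1"
  defines "c \<equiv> l powr (1 / (m - 1))"
  shows "weak_dual_solution_on T G m (\<lambda>x. c * u0 x) (\<lambda>t x. c * u (l * t) x)"
proof -
  note S = sol[unfolded weak_dual_solution_on_def]
  define v where "v t x = c * u (l * t) x" for t x
  have c: "c > 0" using l by (simp add: c_def)
  have cm: "c powr m = c * l"
  proof -
    have "c powr m = l powr (1 / (m - 1) * m)"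
      by (simp add: c_def powr_powr)
    also have "1 / (m - 1) * m = 1 / (m - 1) + 1"
      using m by (simp add: field_simps)
    finally show ?thesis using l by (simp add: c_def powr_add)
  qed
  have mem: "l * t \<in> {0..l * T} \<longleftrightarrow> t \<in> {0..T}" "l * t \<in> {0<..<l * T} \<longleftrightarrow> t \<in> {0<..<T}" for t
    using l by (auto simp: zero_le_mult_iff zero_less_mult_iff)
  have pos: "\<forall>t\<in>{0..T}. \<forall>x. 0 \<le> c * u (l * t) x"
    using S c mem by (metis less_imp_le mult_nonneg_nonneg)
  have meas: "set_borel_measurable borel ({0<..<T} \<times> UNIV) (\<lambda>(t, x). c * u (l * t) x)"
    using S by (intro set_borel_measurable_scale_fst[where S = "{0<..<l * T}"] mem) blast
  have cont: "continuous_into_L1 T (\<lambda>t x. c * u (l * t) x)"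
    unfolding continuous_into_L1_def
  proof safe
    fix t assume t: "t \<in> {0..T}"
    have C: "\<forall>t\<in>{0..l * T}. integrable lborel (u t) \<and>
        ((\<lambda>s. Lp_norm 1 (\<lambda>x. u s x - u t x)) \<longlongrightarrow> 0) (at t within {0..l * T})"
      using S unfolding continuous_into_L1_def by blast
    then have int: "integrable lborel (u (l * s))" if "s \<in> {0..T}" for s
      using that mem by blast
    then show "integrable lborel (\<lambda>x. c * u (l * t) x)"
      using t by auto
    have "((\<lambda>s. Lp_norm 1 (\<lambda>x. u s x - u (l * t) x)) \<longlongrightarrow> 0) (at (l * t) within {l * 0..l * T})"
      using C t mem by simp
    from filterlim_compose[OF this filterlim_scale_at_within_Icc[OF l]]
    have "((\<lambda>s. ennreal c * Lp_norm 1 (\<lambda>x. u (l * s) x - u (l * t) x)) \<longlongrightarrow> ennreal c * 0)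
        (at t within {0..T})"
      by (intro ennreal_tendsto_cmult) auto
    moreover have "\<forall>\<^sub>F s in at t within {0..T}.
        ennreal c * Lp_norm 1 (\<lambda>x. u (l * s) x - u (l * t) x) =
        Lp_norm 1 (\<lambda>x. c * u (l * s) x - c * u (l * t) x)"
    proof -
      have "ennreal c * Lp_norm 1 (\<lambda>x. u (l * s) x - u (l * t) x) =
        Lp_norm 1 (\<lambda>x. c * u (l * s) x - c * u (l * t) x)" if "s \<in> {0..T}" for s
        using int[OF that] int[OF t] c
        by (subst right_diff_distrib[symmetric], subst Lp_norm_1_cmult) auto
      then show ?thesis by (auto simp: eventually_at_filter)
    qed
    ultimately show "((\<lambda>s. Lp_norm 1 (\<lambda>x. c * u (l * s) x - c * u (l * t) x)) \<longlongrightarrow> 0)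
        (at t within {0..T})"
      by (auto elim: Lim_transform_eventually)
  qed
  have powr_int: "\<forall>K. compact K \<longrightarrow>
      set_integrable lborel ({0<..<T} \<times> K) (\<lambda>(t, x). (c * u (l * t) x) powr m)"
  proof safe
    fix K :: "'a set" assume "compact K"
    then have "set_integrable lborel ({0<..<l * T} \<times> K) (\<lambda>(t, x). u t x powr m)"
      using S by blast
    from integrable_scale_fst[OF l this[unfolded set_integrable_def]]
    have "integrable lborel (\<lambda>p. c * l * (indicator ({0<..<l * T} \<times> K) (l * fst p, snd p) *
        u (l * fst p) (snd p) powr m))"
      by (intro integrable_mult_right) auto
    also have "(\<lambda>p. c * l * (indicator ({0<..<l * T} \<times> K) (l * fst p, snd p) *
        u (l * fst p) (snd p) powr m)) =
      (\<lambda>p. indicator ({0<..<T} \<times> K) p *\<^sub>R (case p of (t, x) \<Rightarrow> (c * u (l * t) x) powr m))"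
    proof
      fix p :: "real \<times> 'a"
      obtain t x where p: "p = (t, x)" by (cases p)
      show "c * l * (indicator ({0<..<l * T} \<times> K) (l * fst p, snd p) *
        u (l * fst p) (snd p) powr m) =
        indicator ({0<..<T} \<times> K) p *\<^sub>R (case p of (t, x) \<Rightarrow> (c * u (l * t) x) powr m)"
      proof (cases "t \<in> {0<..<T} \<and> x \<in> K")
        case True
        then have "0 \<le> u (l * t) x"
          using S mem[of t] by auto
        then show ?thesis
          using True c mem(2)[of t] by (simp add: p powr_mult cm)
      next
        case False
        then show ?thesis using mem(2)[of t] by (auto simp: p)
      qed
    qed
    finally show "set_integrable lborel ({0<..<T} \<times> K) (\<lambda>(t, x). (c * u (l * t) x) powr m)"
      by (simp add: set_integrable_def)
  qed
  have conv: "AE t in lborel. 0 < t \<and> t < T \<longrightarrow> inverse_op_converges G (\<lambda>x. c * u (l * t) x)"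
  proof -
    have "AE t in lborel. 0 < t \<and> t < l * T \<longrightarrow> inverse_op_converges G (u t)"
      using S by blast
    from AE_lborel_scaleR[OF l this] show ?thesis
    proof eventually_elim
      case (elim t)
      show ?case
      proof
        assume "0 < t \<and> t < T"
        then have "AE y in lborel. integrable lborel (\<lambda>x. G 0 (x - y) * u (l * t) x)"
          using elim l by (simp add: inverse_op_converges_def)
        then show "inverse_op_converges G (\<lambda>x. c * u (l * t) x)"
          unfolding inverse_op_converges_def
        proof eventually_elim
          case (elim y)
          from integrable_mult_right[OF elim, of c] show ?case
            by (simp add: ac_simps)
        qed
      qed
    qed
  qed
  have dual: "dual_identity G m v \<tau>1 \<tau>2 \<psi> \<psi>'"
    if \<tau>: "0 < \<tau>1" "\<tau>1 \<le> \<tau>2" "\<tau>2 \<le> T"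
      and id: "\<And>\<psi> \<psi>'. C1_Linf_test (l * \<tau>1) (l * \<tau>2) \<psi> \<psi>' \<Longrightarrow>
        dual_identity G m u (l * \<tau>1) (l * \<tau>2) \<psi> \<psi>'"
      and test: "C1_Linf_test \<tau>1 \<tau>2 \<psi> \<psi>'" for \<tau>1 \<tau>2 \<psi> \<psi>'
  proof -
    \<comment> \<open>The identity for \<open>v\<close> is \<open>c\<close> times the one for \<open>u\<close> with the test function \<open>\<psi> (s / l)\<close>.\<close>
    have "C1_Linf_test (l * \<tau>1) (l * \<tau>2) (\<lambda>s. \<psi> (1 / l * s)) (\<lambda>s x. 1 / l * \<psi>' (1 / l * s) x)"
      using test l by (intro C1_Linf_test_scale) auto
    from id[OF this, unfolded dual_identity_def] l
    have I: "set_integrable lborel ({l * \<tau>1..l * \<tau>2} \<times> UNIV)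
             (\<lambda>(t, x). inverse_op G (u t) x * (\<psi>' (t / l) x / l) - u t x powr m * \<psi> (t / l) x)"
           "integrable lborel (\<lambda>x. inverse_op G (u (l * \<tau>2)) x * \<psi> \<tau>2 x)"
           "integrable lborel (\<lambda>x. inverse_op G (u (l * \<tau>1)) x * \<psi> \<tau>1 x)"
       and E: "(LINT t:{l * \<tau>1..l * \<tau>2}|lborel. LINT x|lborel.
               inverse_op G (u t) x * (\<psi>' (t / l) x / l) - u t x powr m * \<psi> (t / l) x) =
             (LINT x|lborel. inverse_op G (u (l * \<tau>2)) x * \<psi> \<tau>2 x) -
             (LINT x|lborel. inverse_op G (u (l * \<tau>1)) x * \<psi> \<tau>1 x)"
      by auto
    have mem': "l * t \<in> {l * \<tau>1..l * \<tau>2} \<longleftrightarrow> t \<in> {\<tau>1..\<tau>2}" for t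
      using l by auto
    have integrand: "inverse_op G (\<lambda>x. c * u (l * t) x) x * \<psi>' t x - (c * u (l * t) x) powr m * \<psi> t x
      = c * l * (inverse_op G (u (l * t)) x * (\<psi>' t x / l) - u (l * t) x powr m * \<psi> t x)"
      if "t \<in> {\<tau>1..\<tau>2}" for t x
    proof -
      have "0 \<le> u (l * t) x"
        using S mem(1)[of t] that \<tau> by auto
      then show ?thesis
        using c l by (simp add: inverse_op_cmult powr_mult cm field_simps)
    qed
    from integrable_scale_fst[OF l I(1)[unfolded set_integrable_def]]
    have "integrable lborel (\<lambda>p. c * l * (indicator ({l * \<tau>1..l * \<tau>2} \<times> UNIV) (l * fst p, snd p) *
        (inverse_op G (u (l * fst p)) (snd p) * (\<psi>' (fst p) (snd p) / l) -
         u (l * fst p) (snd p) powr m * \<psi> (fst p) (snd p))))"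
      using l by (intro integrable_mult_right) auto
    also have "(\<lambda>p. c * l * (indicator ({l * \<tau>1..l * \<tau>2} \<times> UNIV) (l * fst p, snd p) *
        (inverse_op G (u (l * fst p)) (snd p) * (\<psi>' (fst p) (snd p) / l) -
         u (l * fst p) (snd p) powr m * \<psi> (fst p) (snd p)))) =
      (\<lambda>p. indicator ({\<tau>1..\<tau>2} \<times> UNIV) p *\<^sub>R (case p of (t, x) \<Rightarrow>
        inverse_op G (\<lambda>x. c * u (l * t) x) x * \<psi>' t x - (c * u (l * t) x) powr m * \<psi> t x))"
    proof
      fix p :: "real \<times> 'a"
      obtain t x where p: "p = (t, x)" by (cases p)
      show "c * l * (indicator ({l * \<tau>1..l * \<tau>2} \<times> UNIV) (l * fst p, snd p) *
        (inverse_op G (u (l * fst p)) (snd p) * (\<psi>' (fst p) (snd p) / l) -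
         u (l * fst p) (snd p) powr m * \<psi> (fst p) (snd p))) =
        indicator ({\<tau>1..\<tau>2} \<times> UNIV) p *\<^sub>R (case p of (t, x) \<Rightarrow>
        inverse_op G (\<lambda>x. c * u (l * t) x) x * \<psi>' t x - (c * u (l * t) x) powr m * \<psi> t x)"
        using mem'[of t] integrand[of t x] by (cases "t \<in> {\<tau>1..\<tau>2}") (simp_all add: p)
    qed
    finally have 1: "set_integrable lborel ({\<tau>1..\<tau>2} \<times> UNIV)
       (\<lambda>(t, x). inverse_op G (\<lambda>x. c * u (l * t) x) x * \<psi>' t x - (c * u (l * t) x) powr m * \<psi> t x)"
      by (simp add: set_integrable_def)
    have 2: "integrable lborel (\<lambda>x. inverse_op G (\<lambda>x. c * u (l * \<tau>) x) x * \<psi> \<tau> x)"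
      if "integrable lborel (\<lambda>x. inverse_op G (u (l * \<tau>)) x * \<psi> \<tau> x)" for \<tau>
      using integrable_mult_right[OF that, of c] by (simp add: inverse_op_cmult ac_simps)
    define H where "H s = (LINT x|lborel.
        inverse_op G (u s) x * (\<psi>' (s / l) x / l) - u s x powr m * \<psi> (s / l) x)" for s
    have "(LINT t:{\<tau>1..\<tau>2}|lborel. LINT x|lborel.
        inverse_op G (\<lambda>x. c * u (l * t) x) x * \<psi>' t x - (c * u (l * t) x) powr m * \<psi> t x) =
      (LINT t|lborel. c * l * (indicator {l * \<tau>1..l * \<tau>2} (l * t) * H (l * t)))"
      unfolding set_lebesgue_integral_def
    proof (rule Bochner_Integration.integral_cong[OF refl])
      fix t
      show "indicator {\<tau>1..\<tau>2} t *\<^sub>R (LINT x|lborel.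
        inverse_op G (\<lambda>x. c * u (l * t) x) x * \<psi>' t x - (c * u (l * t) x) powr m * \<psi> t x) =
        c * l * (indicator {l * \<tau>1..l * \<tau>2} (l * t) * H (l * t))"
        using mem'[of t] integrand[of t] l
        by (cases "t \<in> {\<tau>1..\<tau>2}") (simp_all add: H_def)
    qed
    also have "\<dots> = c * (l * (LINT t|lborel. indicator {l * \<tau>1..l * \<tau>2} (l * t) * H (l * t)))"
      by simp
    also have "l * (LINT t|lborel. indicator {l * \<tau>1..l * \<tau>2} (l * t) * H (l * t)) =
      (LINT s:{l * \<tau>1..l * \<tau>2}|lborel. H s)"
      using lborel_integral_real_affine[of l "\<lambda>s. indicator {l * \<tau>1..l * \<tau>2} s * H s" 0] l
      by (simp add: set_lebesgue_integral_def)
    also have "c * \<dots> = (LINT x|lborel. inverse_op G (\<lambda>x. c * u (l * \<tau>2) x) x * \<psi> \<tau>2 x) -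
             (LINT x|lborel. inverse_op G (\<lambda>x. c * u (l * \<tau>1) x) x * \<psi> \<tau>1 x)"
      unfolding H_def E by (simp add: inverse_op_cmult mult.assoc right_diff_distrib)
    finally show ?thesis
      unfolding dual_identity_def v_def using 1 2 I by blast
  qed
  have "AE (\<tau>1, \<tau>2) in lborel. 0 < \<tau>1 \<and> \<tau>1 \<le> \<tau>2 \<and> \<tau>2 \<le> T \<longrightarrow>
        (\<forall>\<psi> \<psi>'. C1_Linf_test \<tau>1 \<tau>2 \<psi> \<psi>' \<longrightarrow> dual_identity G m v \<tau>1 \<tau>2 \<psi> \<psi>')"
    using AE_lborel_scaleR[OF l weak_dual_solution_on_dual_identity[OF sol]]
  proof eventually_elim
    case (elim p)
    obtain a b where p: "p = (a, b)" by (cases p)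
    show ?case
      unfolding p prod.case
    proof (intro impI allI)
      fix \<psi> \<psi>' :: "real \<Rightarrow> 'a \<Rightarrow> real"
      assume ab: "0 < a \<and> a \<le> b \<and> b \<le> T" and test: "C1_Linf_test a b \<psi> \<psi>'"
      have lab: "0 < l * a \<and> l * a \<le> l * b \<and> l * b \<le> l * T"
        using ab l by auto
      note id = elim[unfolded p scaleR_Pair real_scaleR_def prod.case, rule_format, OF lab]
      show "dual_identity G m v a b \<psi> \<psi>'"
        using ab by (intro dual[OF _ _ _ id test]) auto
    qed
  qed
  moreover have "AE x in lborel. c * u (l * 0) x = c * u0 x"
  proof -
    have "AE x in lborel. u 0 x = u0 x" using S by blast
    then show ?thesis by eventually_elim simp
  qed
  ultimately show ?thesis
    unfolding weak_dual_solution_on_def using pos meas cont powr_int conv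
    unfolding dual_identity_def v_def by blast
qed

lemma weak_dual_solution_scale:
  assumes "weak_dual_solution G m u0 u" "l > 0" "m > 1"
  shows "weak_dual_solution G m (\<lambda>x. l powr (1 / (m - 1)) * u0 x)
    (\<lambda>t x. l powr (1 / (m - 1)) * u (l * t) x)"
  using assms unfolding weak_dual_solution_def
  by (intro allI impI weak_dual_solution_on_scale) auto

section \<open>Boundedness from a convolution inequality\<close>

lemma AE_lborel_shift:
  fixes P :: "'a::euclidean_space \<Rightarrow> bool"
  assumes "AE x in lborel. P x"
  shows "AE x in lborel. P (x - a)"
proof -
  have "AE x in distr lborel borel ((+) (- a)). P x"
    unfolding lborel_distr_plus by fact
  then have "AE x in lborel. P (- a + x)"
    by (rule AE_distrD[rotated]) auto
  then show ?thesis by simp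
qed

lemma nn_integral_lborel_shift:
  fixes h :: "'a::euclidean_space \<Rightarrow> ennreal"
  assumes [measurable]: "h \<in> borel_measurable borel"
  shows "(\<integral>\<^sup>+ y. h (y - x) \<partial>lborel) = (\<integral>\<^sup>+ y. h y \<partial>lborel)"
proof -
  have "(\<integral>\<^sup>+ y. h y \<partial>lborel) = (\<integral>\<^sup>+ y. h y \<partial>distr lborel borel ((+) (- x)))"
    unfolding lborel_distr_plus ..
  also have "\<dots> = (\<integral>\<^sup>+ y. h (- x + y) \<partial>lborel)"
    by (rule nn_integral_distr) auto
  finally show ?thesis by simp
qed

lemma nn_integral_lborel_reflect:
  fixes h :: "'a::euclidean_space \<Rightarrow> ennreal"
  assumes [measurable]: "h \<in> borel_measurable borel"
  shows "(\<integral>\<^sup>+ x. h (y - x) \<partial>lborel) = (\<integral>\<^sup>+ x. h x \<partial>lborel)"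
proof -
  have "(\<integral>\<^sup>+ x. h x \<partial>lborel) =
      (\<integral>\<^sup>+ x. h x \<partial>density (distr lborel borel (\<lambda>x. y + (-1) *\<^sub>R x)) (\<lambda>_. \<bar>-1 :: real\<bar> ^ DIM('a)))"
    by (subst lborel_affine[of "-1" y]) auto
  also have "\<dots> = (\<integral>\<^sup>+ x. h x \<partial>distr lborel borel (\<lambda>x. y + (-1) *\<^sub>R x))"
    by (simp add: density_1)
  also have "\<dots> = (\<integral>\<^sup>+ x. h (y + (-1) *\<^sub>R x) \<partial>lborel)"
    by (rule nn_integral_distr) auto
  finally show ?thesis by simp
qed

text \<open>Convexity of \<open>s \<mapsto> s\<^sup>m\<close>: the graph lies above its tangent at \<open>L\<close>.\<close>

lemma powr_ge_tangent:
  fixes s L m :: real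
  assumes "0 < L" "L \<le> s" "1 < m"
  shows "L powr m + m * L powr (m - 1) * (s - L) \<le> s powr m"
proof (cases "s = L")
  case False
  have "\<exists>z>L. z < s \<and> s powr m - L powr m = (s - L) * (m * z powr (m - 1))"
    using assms False by (intro MVT2) (auto intro!: has_real_derivative_powr)
  then obtain z where z: "L < z" "z < s" and eq: "s powr m - L powr m = (s - L) * (m * z powr (m - 1))"
    by blast
  have "(s - L) * (m * L powr (m - 1)) \<le> (s - L) * (m * z powr (m - 1))"
    using z assms by (intro mult_left_mono powr_mono2) auto
  then show ?thesis using eq by (simp add: algebra_simps)
qed (use assms in simp)

text \<open>
  A nonnegative kernel with mass at most \<open>k1\<close> inside the ball of radius \<open>R\<close> and values at most \<open>k2\<close>
  outside.
\<close>

locale kernel_split =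
  fixes g :: "'a::euclidean_space \<Rightarrow> real" and R k1 k2 :: real
  assumes g_measurable[measurable]: "g \<in> borel_measurable borel"
    and g_nonneg: "AE x in lborel. 0 \<le> g x"
    and k_nonneg: "0 \<le> k1" "0 \<le> k2"
    and inner: "(\<integral>\<^sup>+ x. ennreal (g x) * indicator (ball 0 R) x \<partial>lborel) \<le> ennreal k1"
    and outer: "AE x in lborel. x \<notin> ball 0 R \<longrightarrow> g x \<le> k2"
begin

text \<open>
  \<open>conv f\<close> is the potential of \<open>f\<close>, as an extended nonnegative integral.  In \<open>conv_inner f\<close> the
  kernel is replaced by \<open>g_inner\<close>, its restriction to the ball.
\<close>

definition conv :: "('a \<Rightarrow> real) \<Rightarrow> 'a \<Rightarrow> ennreal" where
  "conv f x = (\<integral>\<^sup>+ y. ennreal (g (y - x) * f y) \<partial>lborel)"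

definition g_inner :: "'a \<Rightarrow> ennreal" where
  "g_inner y = ennreal (g y) * indicator (ball 0 R) y"

lemma g_inner_measurable[measurable]: "g_inner \<in> borel_measurable borel"
  unfolding g_inner_def
  by (intro borel_measurable_times_ennreal borel_measurable_indicator) auto

definition conv_inner :: "('a \<Rightarrow> real) \<Rightarrow> 'a \<Rightarrow> ennreal" where
  "conv_inner f x = (\<integral>\<^sup>+ y. g_inner (y - x) * ennreal (f y) \<partial>lborel)"

lemma conv_le:
  assumes [measurable]: "f \<in> borel_measurable borel" "w \<in> borel_measurable borel"
    and f: "\<And>x. 0 \<le> f x" and w: "\<And>x. 0 \<le> w x" and L: "0 \<le> L" and M: "0 \<le> M"
    and fw: "AE x in lborel. f x \<le> w x + L"
    and mass: "(\<integral>\<^sup>+ x. ennreal (f x) \<partial>lborel) \<le> ennreal M"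
  shows "conv f x \<le> conv_inner w x + ennreal (L * k1 + k2 * M)"
proof -
  have "conv f x \<le> (\<integral>\<^sup>+ y. g_inner (y - x) * ennreal (w y) + ennreal L * g_inner (y - x)
      + ennreal k2 * ennreal (f y) \<partial>lborel)"
    unfolding conv_def
  proof (rule nn_integral_mono_AE)
    show "AE y in lborel. ennreal (g (y - x) * f y) \<le> g_inner (y - x) * ennreal (w y)
      + ennreal L * g_inner (y - x) + ennreal k2 * ennreal (f y)"
      using AE_lborel_shift[OF g_nonneg, of x] AE_lborel_shift[OF outer, of x] fw
    proof eventually_elim
      case (elim y)
      show ?case
      proof (cases "y - x \<in> ball 0 R")
        case True
        have "g (y - x) * f y \<le> g (y - x) * w y + L * g (y - x) + k2 * f y"
          using mult_left_mono[OF elim(3) elim(1)] mult_nonneg_nonneg[OF k_nonneg(2) f[of y]]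
          by (simp add: algebra_simps)
        then have "ennreal (g (y - x) * f y) \<le> ennreal (g (y - x) * w y + L * g (y - x) + k2 * f y)"
          by (rule ennreal_leI)
        also have "\<dots> = ennreal (g (y - x)) * ennreal (w y) + ennreal L * ennreal (g (y - x))
            + ennreal k2 * ennreal (f y)"
          using elim(1) w[of y] f[of y] L k_nonneg by (simp add: ennreal_mult)
        finally show ?thesis
          using True by (simp add: g_inner_def)
      next
        case False
        then have "g (y - x) * f y \<le> k2 * f y"
          using elim f[of y] by (intro mult_right_mono) auto
        then have "ennreal (g (y - x) * f y) \<le> ennreal k2 * ennreal (f y)"
          using k_nonneg f[of y] by (simp add: ennreal_mult[symmetric])
        then show ?thesis by (simp add: add_increasing)
      qed
    qed
  qed
  also have "\<dots> = conv_inner w x + ennreal L * (\<integral>\<^sup>+ y. g_inner (y - x) \<partial>lborel)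
      + ennreal k2 * (\<integral>\<^sup>+ y. ennreal (f y) \<partial>lborel)"
    by (simp add: nn_integral_add nn_integral_cmult conv_inner_def)
  also have "(\<integral>\<^sup>+ y. g_inner (y - x) \<partial>lborel) = (\<integral>\<^sup>+ y. g_inner y \<partial>lborel)"
    by (rule nn_integral_lborel_shift) simp
  also have "conv_inner w x + ennreal L * (\<integral>\<^sup>+ y. g_inner y \<partial>lborel)
      + ennreal k2 * (\<integral>\<^sup>+ y. ennreal (f y) \<partial>lborel) \<le>
      conv_inner w x + ennreal L * ennreal k1 + ennreal k2 * ennreal M"
    using inner mass by (intro add_mono mult_left_mono order_refl) (auto simp: g_inner_def)
  also have "\<dots> = conv_inner w x + ennreal (L * k1 + k2 * M)"
    using L M k_nonneg by (simp add: ennreal_mult add.assoc)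
  finally show ?thesis .
qed

lemma nn_integral_conv_inner_le:
  assumes [measurable]: "w \<in> borel_measurable borel"
  shows "(\<integral>\<^sup>+ x. conv_inner w x \<partial>lborel) \<le> ennreal k1 * (\<integral>\<^sup>+ y. ennreal (w y) \<partial>lborel)"
proof -
  have "(\<integral>\<^sup>+ x. conv_inner w x \<partial>lborel) =
    (\<integral>\<^sup>+ y. \<integral>\<^sup>+ x. g_inner (y - x) * ennreal (w y) \<partial>lborel \<partial>lborel)"
    unfolding conv_inner_def by (rule lborel_pair.Fubini') simp
  also have "\<dots> = (\<integral>\<^sup>+ y. (\<integral>\<^sup>+ x. g_inner (y - x) \<partial>lborel) *
      ennreal (w y) \<partial>lborel)"
    by (simp add: nn_integral_multc)
  also have "\<dots> = (\<integral>\<^sup>+ y. (\<integral>\<^sup>+ x. g_inner x \<partial>lborel) *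
      ennreal (w y) \<partial>lborel)"
    by (simp add: nn_integral_lborel_reflect)
  also have "\<dots> = (\<integral>\<^sup>+ x. g_inner x \<partial>lborel) *
      (\<integral>\<^sup>+ y. ennreal (w y) \<partial>lborel)"
    by (simp add: nn_integral_cmult)
  also have "\<dots> \<le> ennreal k1 * (\<integral>\<^sup>+ y. ennreal (w y) \<partial>lborel)"
    using inner by (intro mult_right_mono) (auto simp: g_inner_def)
  finally show ?thesis .
qed

text \<open>
  Let \<open>w = max 0 (f - L)\<close>.  For large \<open>L\<close> the inequality for \<open>f\<close> minus the tangent to \<open>s\<^sup>m\<close> at \<open>L\<close>
  leaves \<open>m L\<^bsup>m-1\<^esup> w \<le> \<kappa> conv_inner w\<close>.  Integration gives \<open>m L\<^bsup>m-1\<^esup> \<parallel>w\<parallel>\<^sub>1 \<le> \<kappa> k1 \<parallel>w\<parallel>\<^sub>1\<close>, and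
  as \<open>\<parallel>w\<parallel>\<^sub>1\<close> is finite and \<open>\<kappa> k1 < m L\<^bsup>m-1\<^esup>\<close>, it vanishes.
\<close>

lemma bounded_of_powr_le_conv:
  assumes [measurable]: "f \<in> borel_measurable borel"
    and f: "\<And>x. 0 \<le> f x" and M: "0 \<le> M" and m: "1 < m" and \<kappa>: "0 < \<kappa>"
    and mass: "(\<integral>\<^sup>+ x. ennreal (f x) \<partial>lborel) \<le> ennreal M"
    and le: "AE x in lborel. ennreal (f x powr m) \<le> ennreal \<kappa> * conv f x"
  obtains L where "0 \<le> L" "AE x in lborel. f x \<le> L"
proof -
  \<comment> \<open>\<open>B = L\<^bsup>m-1\<^esup>\<close> exceeds \<open>\<kappa> k1\<close>, and \<open>L \<ge> 1\<close> makes \<open>L\<^sup>m = L B\<close> absorb \<open>\<kappa> (L k1 + k2 M)\<close>.\<close>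
  define B where "B = \<kappa> * (k1 + k2 * M) + 1"
  define L where "L = B powr (1 / (m - 1))"
  have B: "B \<ge> 1" using \<kappa> k_nonneg M by (simp add: B_def)
  have L: "L \<ge> 1" using B m by (simp add: L_def ge_one_powr_ge_zero)
  have LB: "L powr (m - 1) = B"
    using B m by (simp add: L_def powr_powr)
  have Lm: "L powr m = L * B"
    using LB L powr_mult_base[of L "m - 1"] by simp
  define w where "w x = max 0 (f x - L)" for x
  have w[measurable]: "w \<in> borel_measurable borel" unfolding w_def by measurable
  have [measurable]: "conv_inner w \<in> borel_measurable lborel"
    unfolding conv_inner_def by measurable
  have "AE x in lborel. ennreal (m * B) * ennreal (w x) \<le> ennreal \<kappa> * conv_inner w x"
    using le
  proof eventually_elim
    case (elim x)
    show ?case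
    proof (cases "f x \<le> L \<or> conv_inner w x = top")
      case True
      then show ?thesis using \<kappa> by (auto simp: w_def ennreal_mult_top)
    next
      case False
      then obtain j where j: "0 \<le> j" "conv_inner w x = ennreal j"
        by (cases "conv_inner w x") auto
      have "ennreal (f x powr m) \<le> ennreal \<kappa> * (ennreal j + ennreal (L * k1 + k2 * M))"
      proof (rule order_trans[OF elim mult_left_mono])
        have "conv f x \<le> conv_inner w x + ennreal (L * k1 + k2 * M)"
          by (rule conv_le) (use f L M mass in \<open>auto simp: w_def\<close>)
        then show "conv f x \<le> ennreal j + ennreal (L * k1 + k2 * M)" by (simp add: j)
      qed simp
      also have "\<dots> = ennreal (\<kappa> * (j + (L * k1 + k2 * M)))"
        using \<kappa> j L M k_nonneg by (simp add: ennreal_mult)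
      finally have 1: "f x powr m \<le> \<kappa> * (j + (L * k1 + k2 * M))"
        using \<kappa> j L M k_nonneg by (subst (asm) ennreal_le_iff) auto
      have "L powr m + m * L powr (m - 1) * (f x - L) \<le> f x powr m"
        using L False m by (intro powr_ge_tangent) auto
      moreover have "\<kappa> * (L * k1 + k2 * M) \<le> L * B"
      proof -
        have "k2 * M \<le> L * (k2 * M)"
          using mult_right_mono[OF L, of "k2 * M"] k_nonneg M by simp
        then have "\<kappa> * (L * k1 + k2 * M) \<le> \<kappa> * (L * k1 + L * (k2 * M))"
          using \<kappa> by simp
        also have "\<dots> \<le> L * B" using L by (simp add: B_def algebra_simps)
        finally show ?thesis .
      qed
      ultimately have "m * B * w x \<le> \<kappa> * j"
        using 1 False Lm LB by (simp add: w_def algebra_simps)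
      then show ?thesis
        using j \<kappa> B m by (simp add: ennreal_mult[symmetric] w_def)
    qed
  qed
  then have "(\<integral>\<^sup>+ x. ennreal (m * B) * ennreal (w x) \<partial>lborel) \<le> (\<integral>\<^sup>+ x. ennreal \<kappa> * conv_inner w x \<partial>lborel)"
    by (rule nn_integral_mono_AE)
  then have "ennreal (m * B) * (\<integral>\<^sup>+ x. ennreal (w x) \<partial>lborel) \<le> ennreal \<kappa> * (\<integral>\<^sup>+ x. conv_inner w x \<partial>lborel)"
    by (simp add: nn_integral_cmult)
  also have "\<dots> \<le> ennreal \<kappa> * (ennreal k1 * (\<integral>\<^sup>+ x. ennreal (w x) \<partial>lborel))"
    by (intro mult_left_mono nn_integral_conv_inner_le) auto
  finally have W: "ennreal (m * B) * (\<integral>\<^sup>+ x. ennreal (w x) \<partial>lborel) \<le>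
    ennreal \<kappa> * (ennreal k1 * (\<integral>\<^sup>+ x. ennreal (w x) \<partial>lborel))" .
  have "(\<integral>\<^sup>+ x. ennreal (w x) \<partial>lborel) \<le> (\<integral>\<^sup>+ x. ennreal (f x) \<partial>lborel)"
    using f L by (intro nn_integral_mono ennreal_leI) (auto simp: w_def)
  also note mass
  finally obtain I where I: "0 \<le> I" "(\<integral>\<^sup>+ x. ennreal (w x) \<partial>lborel) = ennreal I"
    by (cases "\<integral>\<^sup>+ x. ennreal (w x) \<partial>lborel") (auto simp: top_unique)
  have "m * B * I \<le> \<kappa> * (k1 * I)"
    using W \<kappa> k_nonneg m B I by (simp add: ennreal_mult[symmetric])
  moreover have "\<kappa> * k1 < m * B"
  proof -
    have "0 \<le> \<kappa> * (k2 * M)" using \<kappa> k_nonneg M by simp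
    then have "\<kappa> * k1 < B" by (simp add: B_def distrib_left)
    also have "B \<le> m * B" using m B by simp
    finally show ?thesis .
  qed
  ultimately have "I = 0"
    using I(1) mult_strict_right_mono[of "\<kappa> * k1" "m * B" I] by (cases "I = 0") auto
  then have "(\<integral>\<^sup>+ x. ennreal (w x) \<partial>lborel) = 0"
    using I(2) by simp
  then have "AE x in lborel. ennreal (w x) = 0"
    by (subst (asm) nn_integral_0_iff_AE) auto
  then have "AE x in lborel. f x \<le> L"
    by eventually_elim (auto simp: w_def ennreal_eq_0_iff)
  then show ?thesis using that[of L] L by simp
qed

text \<open>
  The supremum \<open>S\<close> of \<open>f\<close>, finite by the previous lemma, satisfies
  \<open>S\<^sup>m \<le> \<kappa> k1 S + \<kappa> k2 M\<close>.  Young's inequality with exponents \<open>m\<close> and \<open>m/(m-1)\<close> removes the linear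
  term.
\<close>

lemma sup_le_of_powr_le_conv:
  assumes [measurable]: "f \<in> borel_measurable borel"
    and f: "\<And>x. 0 \<le> f x" and M: "0 \<le> M" and m: "1 < m" and \<kappa>: "0 < \<kappa>"
    and mass: "(\<integral>\<^sup>+ x. ennreal (f x) \<partial>lborel) \<le> ennreal M"
    and le: "AE x in lborel. ennreal (f x powr m) \<le> ennreal \<kappa> * conv f x"
  shows "esssup lborel (\<lambda>x. ennreal (f x)) \<le>
    ennreal (((\<kappa> * k1) powr (m / (m - 1)) + m / (m - 1) * (\<kappa> * (k2 * M))) powr (1 / m))"
proof -
  obtain L where L: "0 \<le> L" "AE x in lborel. f x \<le> L"
    using bounded_of_powr_le_conv[OF assms] by blast
  have "esssup lborel (\<lambda>x. ennreal (f x)) \<le> ennreal L"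
    using L by (intro esssup_I) (auto elim!: eventually_mono intro: ennreal_leI)
  then obtain S where S: "0 \<le> S" "esssup lborel (\<lambda>x. ennreal (f x)) = ennreal S"
    by (cases "esssup lborel (\<lambda>x. ennreal (f x))") (auto simp: top_unique)
  have fS: "AE x in lborel. f x \<le> S"
    using esssup_AE[of "\<lambda>x. ennreal (f x)" lborel] S f by simp
  have nn: "0 \<le> \<kappa> * (S * k1 + k2 * M)"
    using S M \<kappa> k_nonneg by simp
  have "AE x in lborel. f x \<le> (\<kappa> * (S * k1 + k2 * M)) powr (1 / m)"
    using le
  proof eventually_elim
    case (elim x)
    \<comment> \<open>Here \<open>f \<le> 0 + S\<close> almost everywhere, so the excess over \<open>S\<close> is \<open>0\<close>.\<close>
    have "conv f x \<le> conv_inner (\<lambda>_. 0) x + ennreal (S * k1 + k2 * M)"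
      using S M f fS mass by (intro conv_le) auto
    also have "conv_inner (\<lambda>_. 0) x = 0"
      by (simp add: conv_inner_def)
    finally have "ennreal (f x powr m) \<le> ennreal \<kappa> * ennreal (S * k1 + k2 * M)"
      by (intro order_trans[OF elim mult_left_mono]) auto
    also have "\<dots> = ennreal (\<kappa> * (S * k1 + k2 * M))"
      using \<kappa> S M k_nonneg by (simp only: ennreal_mult add_nonneg_nonneg mult_nonneg_nonneg less_imp_le)
    finally have "f x powr m \<le> \<kappa> * (S * k1 + k2 * M)"
      using nn by (subst (asm) ennreal_le_iff)
    then have "(f x powr m) powr (1 / m) \<le> (\<kappa> * (S * k1 + k2 * M)) powr (1 / m)"
      using m by (intro powr_mono2) auto
    then show ?case using m f[of x] by (simp add: powr_powr)
  qed
  then have "ennreal S \<le> ennreal ((\<kappa> * (S * k1 + k2 * M)) powr (1 / m))"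
    unfolding S(2)[symmetric] by (intro esssup_I) (auto elim!: eventually_mono intro: ennreal_leI)
  then have "S powr m \<le> ((\<kappa> * (S * k1 + k2 * M)) powr (1 / m)) powr m"
    using m S by (intro powr_mono2) auto
  then have Sm: "S powr m \<le> S * (\<kappa> * k1) + \<kappa> * (k2 * M)"
    using m nn by (simp add: powr_powr algebra_simps)
  define q where "q = m / (m - 1)"
  have q: "q > 1" "1 / m + 1 / q = 1" "q * (1 - 1 / m) = 1"
    using m by (auto simp: q_def field_simps)
  have "S * (\<kappa> * k1) \<le> S powr m / m + (\<kappa> * k1) powr q / q"
    using m q S \<kappa> k_nonneg by (intro Youngs_inequality) auto
  then have "(1 - 1 / m) * S powr m \<le> (\<kappa> * k1) powr q / q + \<kappa> * (k2 * M)"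
    using Sm by (simp add: left_diff_distrib)
  then have "q * ((1 - 1 / m) * S powr m) \<le> q * ((\<kappa> * k1) powr q / q + \<kappa> * (k2 * M))"
    using q by (intro mult_left_mono) auto
  then have "S powr m \<le> (\<kappa> * k1) powr q + q * (\<kappa> * (k2 * M))"
    using q by (simp add: mult.assoc[symmetric] distrib_left)
  then have "(S powr m) powr (1 / m) \<le> ((\<kappa> * k1) powr q + q * (\<kappa> * (k2 * M))) powr (1 / m)"
    using m by (intro powr_mono2) auto
  then show ?thesis
    using m S by (simp add: powr_powr q_def ennreal_leI)
qed

end

section \<open>Time monotonicity and decay of the mass\<close>

lemma AE_lborel_dense:
  fixes a b :: real
  assumes "AE t in lborel. P t" "a < b"
  obtains t where "a < t" "t < b" "P t"
proof -
  have "\<exists>t. a < t \<and> t < b \<and> P t"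
  proof (rule ccontr)
    assume none: "\<nexists>t. a < t \<and> t < b \<and> P t"
    have "AE t in lborel. t \<notin> {a<..<b}"
      using assms(1) none by (auto elim!: eventually_mono)
    then have "{a<..<b} \<in> null_sets lborel"
      by (subst AE_iff_null_sets) auto
    then show False using assms(2) by auto
  qed
  then show ?thesis using that by blast
qed

lemma AE_lborel_sequence_right:
  fixes a :: real
  assumes "AE t in lborel. P t"
  obtains X where "\<And>n. a < X n" "\<And>n. P (X n)" "X \<longlonglongrightarrow> a"
proof -
  have "\<exists>t. a < t \<and> t < a + 1 / Suc n \<and> P t" for n :: nat
    by (rule AE_lborel_dense[OF assms, of a "a + 1 / Suc n"]) auto
  then have "\<exists>X. \<forall>n. a < X n \<and> X n < a + 1 / Suc n \<and> P (X n)"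
    by (intro choice allI)
  then obtain X where X: "\<And>n. a < X n" "\<And>n. X n < a + 1 / Suc n" "\<And>n. P (X n)"
    by blast
  have "(\<lambda>n. a + 1 / Suc n) \<longlonglongrightarrow> a + 0"
    by (intro tendsto_intros LIMSEQ_inverse_real_of_nat[unfolded inverse_eq_divide])
  then have "(\<lambda>n. a + 1 / Suc n) \<longlonglongrightarrow> a" by simp
  then have "X \<longlonglongrightarrow> a"
    using X(1,2) by (intro real_tendsto_sandwich[of "\<lambda>_. a" X sequentially "\<lambda>n. a + 1 / Suc n"])
      (blast intro: always_eventually less_imp_le tendsto_const)+
  then show ?thesis using that X by blast
qed

lemma AE_lborel_pairD:
  assumes "AE (x, y) in lborel. P x y"
  shows "AE x in lborel. AE y in lborel. P x y"
proof -
  have "AE p in lborel \<Otimes>\<^sub>M lborel. case p of (x, y) \<Rightarrow> P x y"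
    using assms unfolding lborel_prod .
  from lborel_pair.AE_pair[OF this] show ?thesis by simp
qed

lemma weak_dual_solution_integrable:
  assumes "weak_dual_solution G m u0 u" "0 \<le> t"
  shows "integrable lborel (u t)"
proof -
  have "weak_dual_solution_on (t + 1) G m u0 u"
    using assms by (simp add: weak_dual_solution_def)
  then show ?thesis
    using assms(2) unfolding weak_dual_solution_on_def continuous_into_L1_def by auto
qed

lemma weak_dual_solution_nonneg:
  assumes "weak_dual_solution G m u0 u" "0 \<le> t"
  shows "0 \<le> u t x"
proof -
  have "weak_dual_solution_on (t + 1) G m u0 u"
    using assms by (simp add: weak_dual_solution_def)
  then show ?thesis
    using assms(2) unfolding weak_dual_solution_on_def by auto
qed

lemma weak_dual_solution_tendsto_L1:
  assumes sol: "weak_dual_solution G m u0 u" and t: "0 \<le> t"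
    and X: "\<And>n. t < X n" "X \<longlonglongrightarrow> t"
  shows "(\<lambda>n. Lp_norm 1 (\<lambda>x. u (X n) x - u t x)) \<longlonglongrightarrow> 0"
proof -
  have "weak_dual_solution_on (t + 1) G m u0 u"
    using sol t by (simp add: weak_dual_solution_def)
  then have *: "((\<lambda>s. Lp_norm 1 (\<lambda>x. u s x - u t x)) \<longlongrightarrow> 0) (at t within {0..t + 1})"
    using t unfolding weak_dual_solution_on_def continuous_into_L1_def by auto
  have "\<forall>\<^sub>F n in sequentially. X n < t + 1"
    using X(2) by (rule order_tendstoD) simp
  then have "filterlim X (at t within {0..t + 1}) sequentially"
    unfolding filterlim_at using X t
    by (auto elim!: eventually_mono intro: less_imp_le order_trans dest: less_imp_neq)
  from filterlim_compose[OF * this] show ?thesis .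
qed

lemma Lp_norm_1_triangle:
  assumes [measurable]: "f \<in> borel_measurable borel" "g \<in> borel_measurable borel"
  shows "Lp_norm 1 f \<le> Lp_norm 1 g + Lp_norm 1 (\<lambda>x. f x - g x)"
proof -
  have "(\<integral>\<^sup>+ x. ennreal \<bar>f x\<bar> \<partial>lborel) \<le> (\<integral>\<^sup>+ x. ennreal \<bar>g x\<bar> + ennreal \<bar>f x - g x\<bar> \<partial>lborel)"
    by (intro nn_integral_mono) (simp add: ennreal_plus[symmetric] ennreal_leI del: ennreal_plus)
  then show ?thesis
    unfolding Lp_norm_1 by (simp add: nn_integral_add)
qed

text \<open>
  Comparison of \<open>u\<close> with its rescaling gives the inequality for almost every \<open>t\<close>; continuity of \<open>u\<close>
  into \<open>L\<^sup>1\<close> extends it to every \<open>t > 0\<close>.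
\<close>

lemma weak_dual_solution_monotone:
  assumes sol: "weak_dual_solution G m u0 u" and comp: "comparison_principle G m"
    and m: "1 < m" and u0: "integrable lborel u0" "AE x in lborel. 0 \<le> u0 x"
    and t: "0 < t" "t \<le> s"
  shows "AE x in lborel. u t x \<le> (s / t) powr (1 / (m - 1)) * u s x"
proof -
  define l where "l = s / t"
  define c where "c = l powr (1 / (m - 1))"
  have l: "l \<ge> 1" "l * t = s" using t by (auto simp: l_def)
  have c: "c \<ge> 1" using l m by (simp add: c_def ge_one_powr_ge_zero)
  have "weak_dual_solution G m (\<lambda>x. c * u0 x) (\<lambda>t x. c * u (l * t) x)"
    unfolding c_def using sol l m by (intro weak_dual_solution_scale) auto
  moreover have "AE x in lborel. u0 x \<le> c * u0 x"
    using u0(2)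
  proof eventually_elim
    case (elim x)
    then show ?case using mult_right_mono[OF c elim] by simp
  qed
  ultimately have "AE (t, x) in lborel. 0 < t \<longrightarrow> u t x \<le> c * u (l * t) x"
    using sol u0 comp[unfolded comparison_principle_def, rule_format,
        of u0 "\<lambda>x. c * u0 x" u "\<lambda>t x. c * u (l * t) x"]
    by blast
  from AE_lborel_pairD[OF this]
  obtain X where X1: "\<And>n. t < X n"
    and le: "\<And>n. AE x in lborel. 0 < X n \<longrightarrow> u (X n) x \<le> c * u (l * X n) x"
    and X2: "X \<longlonglongrightarrow> t"
    by (rule AE_lborel_sequence_right[of _ t]) (rule that)
  note X = X1 X2
  have lX: "\<And>n. s < l * X n" "(\<lambda>n. l * X n) \<longlonglongrightarrow> s"
    using X l t mult_strict_left_mono[OF X(1), of l] tendsto_mult_left[OF X(2), of l] by auto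
  have [measurable]: "u r \<in> borel_measurable borel" if "0 \<le> r" for r
    using weak_dual_solution_integrable[OF sol that] by auto
  have bound: "(\<integral>\<^sup>+ x. ennreal (u t x - c * u s x) \<partial>lborel) \<le>
      Lp_norm 1 (\<lambda>x. u (X n) x - u t x) + ennreal c * Lp_norm 1 (\<lambda>x. u (l * X n) x - u s x)" for n
  proof -
    have [measurable]: "u t \<in> borel_measurable borel" "u s \<in> borel_measurable borel"
      "u (X n) \<in> borel_measurable borel" "u (l * X n) \<in> borel_measurable borel"
      using t X(1)[of n] lX(1)[of n] by auto
    have "(\<integral>\<^sup>+ x. ennreal (u t x - c * u s x) \<partial>lborel) \<le>
      (\<integral>\<^sup>+ x. ennreal \<bar>u (X n) x - u t x\<bar> + ennreal c * ennreal \<bar>u (l * X n) x - u s x\<bar> \<partial>lborel)"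
    proof (rule nn_integral_mono_AE)
      show "AE x in lborel. ennreal (u t x - c * u s x) \<le>
        ennreal \<bar>u (X n) x - u t x\<bar> + ennreal c * ennreal \<bar>u (l * X n) x - u s x\<bar>"
        using le[of n]
      proof eventually_elim
        case (elim x)
        then have "u (X n) x \<le> c * u (l * X n) x"
          using t X(1)[of n] by auto
        moreover have "c * (u (l * X n) x - u s x) \<le> c * \<bar>u (l * X n) x - u s x\<bar>"
          using c by (intro mult_left_mono) auto
        ultimately have "u t x - c * u s x \<le> \<bar>u (X n) x - u t x\<bar> + c * \<bar>u (l * X n) x - u s x\<bar>"
          by (simp add: right_diff_distrib)
        then have "ennreal (u t x - c * u s x) \<le> ennreal (\<bar>u (X n) x - u t x\<bar> + c * \<bar>u (l * X n) x - u s x\<bar>)"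
          by (rule ennreal_leI)
        then show ?case using c by (simp add: ennreal_mult)
      qed
    qed
    also have "\<dots> = Lp_norm 1 (\<lambda>x. u (X n) x - u t x) + ennreal c * Lp_norm 1 (\<lambda>x. u (l * X n) x - u s x)"
      unfolding Lp_norm_1 by (simp add: nn_integral_add nn_integral_cmult)
    finally show ?thesis .
  qed
  have "(\<lambda>n. Lp_norm 1 (\<lambda>x. u (X n) x - u t x) + ennreal c * Lp_norm 1 (\<lambda>x. u (l * X n) x - u s x))
    \<longlonglongrightarrow> 0 + ennreal c * 0"
    using t X lX by (intro tendsto_add ennreal_tendsto_cmult weak_dual_solution_tendsto_L1[OF sol]) auto
  then have "(\<integral>\<^sup>+ x. ennreal (u t x - c * u s x) \<partial>lborel) \<le> 0 + ennreal c * 0"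
    by (rule LIMSEQ_le_const) (use bound in auto)
  then have "(\<integral>\<^sup>+ x. ennreal (u t x - c * u s x) \<partial>lborel) = 0"
    by simp
  then have "AE x in lborel. ennreal (u t x - c * u s x) = 0"
    using t by (subst (asm) nn_integral_0_iff_AE) auto
  then show ?thesis
    by eventually_elim (simp add: ennreal_eq_0_iff c_def l_def)
qed

text \<open>
  The decay relates almost all pairs of times.  A sequence of admissible first times that tends to
  \<open>0\<close>, with continuity in \<open>L\<^sup>1\<close>, brings in the initial data.
\<close>

lemma weak_dual_solution_mass_le:
  assumes sol: "weak_dual_solution G m u0 u" and decay: "Lp_decay G m"
    and u0: "integrable lborel u0"
  shows "AE t in lborel. 0 < t \<longrightarrow> Lp_norm 1 (u t) \<le> Lp_norm 1 u0"
proof -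
  have "AE (\<tau>1, \<tau>2) in lborel. 0 \<le> \<tau>1 \<and> \<tau>1 \<le> \<tau>2 \<longrightarrow> Lp_norm 1 (u \<tau>2) \<le> Lp_norm 1 (u \<tau>1)"
    using decay sol u0 unfolding Lp_decay_def by blast
  from AE_lborel_pairD[OF this]
  obtain X :: "nat \<Rightarrow> real" where X1: "\<And>n. 0 < X n"
    and le: "\<And>n. AE \<tau> in lborel. 0 \<le> X n \<and> X n \<le> \<tau> \<longrightarrow> Lp_norm 1 (u \<tau>) \<le> Lp_norm 1 (u (X n))"
    and X2: "X \<longlonglongrightarrow> 0"
    by (rule AE_lborel_sequence_right[of _ 0]) (rule that)
  note X = X1 X2
  have u_0: "Lp_norm 1 (u 0) = Lp_norm 1 u0"
  proof -
    have "AE x in lborel. u 0 x = u0 x"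
      using sol unfolding weak_dual_solution_def weak_dual_solution_on_def by (meson zero_less_one)
    then show ?thesis
      unfolding Lp_norm_1 by (intro nn_integral_cong_AE) auto
  qed
  have meas: "u r \<in> borel_measurable borel" if "0 \<le> r" for r
    using weak_dual_solution_integrable[OF sol that] by auto
  have "AE \<tau> in lborel. \<forall>n. 0 \<le> X n \<and> X n \<le> \<tau> \<longrightarrow> Lp_norm 1 (u \<tau>) \<le> Lp_norm 1 (u (X n))"
    using le by (simp add: AE_all_countable)
  then show ?thesis
  proof eventually_elim
    case (elim \<tau>)
    show ?case
    proof
      assume "0 < \<tau>"
      then have "\<forall>\<^sub>F n in sequentially. X n < \<tau>"
        using X(2) by (intro order_tendstoD)
      moreover have "Lp_norm 1 (u \<tau>) \<le> Lp_norm 1 u0 + Lp_norm 1 (\<lambda>x. u (X n) x - u 0 x)"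
        if "X n < \<tau>" for n
      proof -
        have "Lp_norm 1 (u \<tau>) \<le> Lp_norm 1 (u (X n))"
          using elim that X(1)[of n] by auto
        also have "\<dots> \<le> Lp_norm 1 (u 0) + Lp_norm 1 (\<lambda>x. u (X n) x - u 0 x)"
          using X(1)[of n] by (intro Lp_norm_1_triangle meas) auto
        finally show ?thesis by (simp add: u_0)
      qed
      ultimately have "\<forall>\<^sub>F n in sequentially.
          Lp_norm 1 (u \<tau>) \<le> Lp_norm 1 u0 + Lp_norm 1 (\<lambda>x. u (X n) x - u 0 x)"
        by (auto elim: eventually_mono)
      moreover have "(\<lambda>n. Lp_norm 1 u0 + Lp_norm 1 (\<lambda>x. u (X n) x - u 0 x)) \<longlonglongrightarrow> Lp_norm 1 u0 + 0"
        by (intro tendsto_intros weak_dual_solution_tendsto_L1[OF sol] X) auto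
      ultimately show "Lp_norm 1 (u \<tau>) \<le> Lp_norm 1 u0"
        using tendsto_lowerbound[of _ "Lp_norm 1 u0 + 0" sequentially] by auto
    qed
  qed
qed

section \<open>The pointwise bound by the potential\<close>

lemma C1_Linf_test_indicator:
  fixes E :: "'a::euclidean_space set"
  assumes [measurable]: "E \<in> sets borel" and E: "bounded E"
  shows "C1_Linf_test a b (\<lambda>_. indicator E) (\<lambda>_ _. 0)"
proof -
  have zero: "Lp_norm \<infinity> (\<lambda>x :: 'a. 0 :: real) = 0"
    unfolding Lp_norm_infinity using esssup_I[of "\<lambda>_. 0 :: ennreal" "lborel :: 'a measure" 0] by simp
  have "Lp_norm \<infinity> (indicator E) \<le> 1"
    unfolding Lp_norm_infinity by (intro esssup_I) (auto simp: indicator_def)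
  then have fin: "Lp_norm \<infinity> (indicator E) < \<infinity>"
    by (rule order_le_less_trans) simp
  have "{a..b} \<times> E \<in> sets (borel :: (real \<times> 'a) measure)"
    unfolding borel_prod[symmetric] by measurable
  then have "(indicator ({a..b} \<times> E) :: real \<times> 'a \<Rightarrow> real) \<in> borel_measurable borel"
    by (rule borel_measurable_indicator)
  also have "indicator ({a..b} \<times> E) =
      (\<lambda>p. indicator ({a..b} \<times> UNIV) p *\<^sub>R (case p of (t :: real, x) \<Rightarrow> indicator E x) :: real)"
    by (auto simp: indicator_def fun_eq_iff)
  finally have "set_borel_measurable borel ({a..b} \<times> UNIV) (\<lambda>(t :: real, x). indicator E x :: real)"
    by (simp add: set_borel_measurable_def)
  moreover have "\<exists>K. compact K \<and> (\<forall>t\<in>{a..b}. AE x in lborel. x \<notin> K \<longrightarrow> (indicator E x :: real) = 0)"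
    using E closure_subset[of E]
    by (intro exI[of _ "closure E"]) (auto simp: compact_closure indicator_def intro!: AE_I2)
  ultimately show ?thesis
    unfolding C1_Linf_test_def
    by (auto simp only: zero fin diff_self div_0 set_borel_measurable_def) auto
qed

lemma inverse_op_nonneg:
  assumes "AE x in lborel. 0 \<le> G 0 x" "\<And>x. 0 \<le> f x"
  shows "0 \<le> inverse_op G f y"
  unfolding inverse_op_def
proof (rule integral_nonneg_AE)
  show "AE x in lborel. 0 \<le> G 0 (x - y) * f x"
    using AE_lborel_shift[OF assms(1), of y] by eventually_elim (simp add: assms)
qed

lemma inverse_op_measurable:
  assumes [measurable]: "G 0 \<in> borel_measurable borel" "f \<in> borel_measurable borel"
  shows "inverse_op G f \<in> borel_measurable borel"
  unfolding inverse_op_def[abs_def] by measurable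

text \<open>
  The dual identity on \<open>[\<tau>,\<sigma>]\<close> with the test function \<open>\<psi> t = indicator E\<close> reads
  \<open>\<integral>\<^sub>\<tau>\<^sup>\<sigma> \<integral>\<^sub>E u\<^sup>m = \<integral>\<^sub>E (-L)\<^bsup>-1\<^esup>[u(\<tau>)] - \<integral>\<^sub>E (-L)\<^bsup>-1\<^esup>[u(\<sigma>)]\<close>.  The last term has a sign, and the hypothesis on
  \<open>[\<tau>,2\<tau>]\<close> bounds the left side below by \<open>(\<sigma> - \<tau>) / C \<integral>\<^sub>E u(\<tau>)\<^sup>m\<close>.  The identity is available only for
  almost every \<open>\<sigma>\<close>, so the value \<open>\<sigma> = 2\<tau>\<close> is reached as a limit.
\<close>

lemma integral_powr_le_integral_inverse_op:
  fixes u :: "real \<Rightarrow> 'a::euclidean_space \<Rightarrow> real"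
  assumes m: "1 < m" and \<tau>: "0 < \<tau>" and C: "0 < C" and E[measurable]: "E \<in> sets borel"
    and nonneg: "\<And>t x. 0 \<le> t \<Longrightarrow> 0 \<le> u t x"
    and meas: "\<And>t. 0 \<le> t \<Longrightarrow> u t \<in> borel_measurable borel"
    and G: "AE x in lborel. 0 \<le> G 0 x"
    and mono: "\<And>t. \<tau> \<le> t \<Longrightarrow> t \<le> 2 * \<tau> \<Longrightarrow> AE x in lborel. u \<tau> x powr m \<le> C * u t x powr m"
    and id: "AE \<sigma> in lborel. \<tau> < \<sigma> \<longrightarrow> dual_identity G m u \<tau> \<sigma> (\<lambda>_. indicator E) (\<lambda>_ _. 0)"
  shows "integrable lborel (\<lambda>x. u \<tau> x powr m * indicator E x)"
    and "integrable lborel (\<lambda>x. inverse_op G (u \<tau>) x * indicator E x)"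
    and "\<tau> * (LINT x|lborel. u \<tau> x powr m * indicator E x) \<le>
      C * (LINT x|lborel. inverse_op G (u \<tau>) x * indicator E x)"
proof -
  define V where "V = (LINT x|lborel. u \<tau> x powr m * indicator E x)"
  define W where "W = (LINT x|lborel. inverse_op G (u \<tau>) x * indicator E x)"
  \<comment> \<open>The estimate for one admissible \<open>\<sigma>\<close>.\<close>
  have good: "integrable lborel (\<lambda>x. u \<tau> x powr m * indicator E x) \<and>
      integrable lborel (\<lambda>x. inverse_op G (u \<tau>) x * indicator E x) \<and> (\<sigma> - \<tau>) * V \<le> C * W"
    if \<sigma>: "\<tau> < \<sigma>" "\<sigma> < 2 * \<tau>" and "dual_identity G m u \<tau> \<sigma> (\<lambda>_. indicator E) (\<lambda>_ _. 0)" for \<sigma>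
  proof -
    define H where "H t = (LINT x|lborel. u t x powr m * indicator E x)" for t
    have I1: "integrable lborel (\<lambda>p. - (indicator ({\<tau>..\<sigma>} \<times> UNIV) p *\<^sub>R
          (case p of (t, x) \<Rightarrow> - (u t x powr m * indicator E x))))"
      and I2: "integrable lborel (\<lambda>x. inverse_op G (u \<tau>) x * indicator E x)"
      and eq: "(LINT t:{\<tau>..\<sigma>}|lborel. - H t) =
        (LINT x|lborel. inverse_op G (u \<sigma>) x * indicator E x) - W"
      using that(3) unfolding dual_identity_def set_integrable_def H_def W_def by auto
    have "integrable (lborel \<Otimes>\<^sub>M lborel) (\<lambda>(t, x). indicator {\<tau>..\<sigma>} t * (u t x powr m * indicator E x))"
      unfolding lborel_prod
      by (rule Bochner_Integration.integrable_cong[THEN iffD1, OF refl _ I1])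
        (auto simp: indicator_def)
    note I = lborel_pair.integrable_fst[OF this] lborel_pair.AE_integrable_fst[OF this]
    have intE: "AE t in lborel. t \<in> {\<tau>..\<sigma>} \<longrightarrow> integrable lborel (\<lambda>x. u t x powr m * indicator E x)"
      using I(2) by eventually_elim auto
    have dom: "AE x in lborel. u \<tau> x powr m * indicator E x \<le> C * (u t x powr m * indicator E x)"
      if "t \<in> {\<tau>..\<sigma>}" for t
      using mono[of t] that \<sigma>(2) by (auto elim!: eventually_mono simp: indicator_def)
    have "integrable lborel (\<lambda>x. u \<tau> x powr m * indicator E x)"
    proof -
      obtain t where t: "\<tau> < t" "t < \<sigma>"
        and int: "t \<in> {\<tau>..\<sigma>} \<longrightarrow> integrable lborel (\<lambda>x. u t x powr m * indicator E x)"
        using AE_lborel_dense[OF intE \<sigma>(1)] .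
      show ?thesis
      proof (rule Bochner_Integration.integrable_bound)
        show "integrable lborel (\<lambda>x. C * (u t x powr m * indicator E x))"
          using int t by auto
        show "AE x in lborel. norm (u \<tau> x powr m * indicator E x) \<le> norm (C * (u t x powr m * indicator E x))"
          using dom[of t] t C by (auto elim!: eventually_mono)
      qed (use meas[of \<tau>] \<tau> in auto)
    qed
    moreover have "(\<sigma> - \<tau>) * V \<le> C * W"
    proof -
      have "(LINT t|lborel. indicator {\<tau>..\<sigma>} t * V) \<le> (LINT t|lborel. C * (indicator {\<tau>..\<sigma>} t * H t))"
      proof (rule integral_mono_AE)
        show "integrable lborel (\<lambda>t. indicator {\<tau>..\<sigma>} t * V)"
          by (intro integrable_mult_left integrable_real_indicator) (auto simp: emeasure_lborel_Icc_eq)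
        show "integrable lborel (\<lambda>t. C * (indicator {\<tau>..\<sigma>} t * H t))"
          using I(1) by (simp add: H_def)
        show "AE t in lborel. indicator {\<tau>..\<sigma>} t * V \<le> C * (indicator {\<tau>..\<sigma>} t * H t)"
          using intE
        proof eventually_elim
          case (elim t)
          show ?case
          proof (cases "t \<in> {\<tau>..\<sigma>}")
            case True
            have "V \<le> (LINT x|lborel. C * (u t x powr m * indicator E x))"
              unfolding V_def using calculation elim True dom by (intro integral_mono_AE) auto
            then show ?thesis using True by (simp add: H_def)
          qed auto
        qed
      qed
      also have "\<dots> = C * (W - (LINT x|lborel. inverse_op G (u \<sigma>) x * indicator E x))"
        using eq by (simp add: set_lebesgue_integral_def)
      also have "\<dots> \<le> C * W"
        using C \<sigma> \<tau> by (intro mult_left_mono)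
          (auto intro!: integral_nonneg_AE AE_I2 mult_nonneg_nonneg inverse_op_nonneg[of G, OF G] nonneg)
      finally show ?thesis
        using \<sigma> by simp
    qed
    ultimately show ?thesis using I2 by blast
  qed
  obtain \<sigma> where "\<tau> < \<sigma>" "\<sigma> < 2 * \<tau>"
    and "\<tau> < \<sigma> \<longrightarrow> dual_identity G m u \<tau> \<sigma> (\<lambda>_. indicator E) (\<lambda>_ _. 0)"
    by (rule AE_lborel_dense[OF id, of \<tau> "2 * \<tau>"]) (use \<tau> in auto)
  from good[OF this(1,2)] this(3) \<open>\<tau> < \<sigma>\<close>
  show "integrable lborel (\<lambda>x. u \<tau> x powr m * indicator E x)"
    "integrable lborel (\<lambda>x. inverse_op G (u \<tau>) x * indicator E x)"
    by auto
  have "0 \<le> W"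
    unfolding W_def using \<tau>
    by (auto intro!: integral_nonneg_AE AE_I2 mult_nonneg_nonneg inverse_op_nonneg[of G, OF G] nonneg)
  have "\<tau> * V \<le> C * W"
  proof (rule ccontr)
    assume "\<not> \<tau> * V \<le> C * W"
    then have less: "C * W < \<tau> * V" by simp
    moreover have "0 \<le> C * W" using C \<open>0 \<le> W\<close> by simp
    ultimately have V: "0 < V" using \<tau> by (metis le_less_trans zero_less_mult_pos)
    \<comment> \<open>An admissible \<open>\<sigma>\<close> close enough to \<open>2\<tau>\<close> contradicts \<open>(\<sigma> - \<tau>) V \<le> C W\<close>.\<close>
    have "\<tau> + C * W / V < 2 * \<tau>"
      using less V by (simp add: field_simps)
    then obtain \<sigma> where \<sigma>: "\<tau> + C * W / V < \<sigma>" "\<sigma> < 2 * \<tau>"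
      and id\<sigma>: "\<tau> < \<sigma> \<longrightarrow> dual_identity G m u \<tau> \<sigma> (\<lambda>_. indicator E) (\<lambda>_ _. 0)"
      by (rule AE_lborel_dense[OF id])
    have "0 \<le> C * W / V" using V \<open>0 \<le> C * W\<close> by simp
    then have "\<tau> < \<sigma>" using \<sigma>(1) by linarith
    then have "(\<sigma> - \<tau>) * V \<le> C * W" using good \<sigma> id\<sigma> by blast
    then show False using \<sigma>(1) V by (simp add: field_simps)
  qed
  then show "\<tau> * (LINT x|lborel. u \<tau> x powr m * indicator E x) \<le>
      C * (LINT x|lborel. inverse_op G (u \<tau>) x * indicator E x)"
    unfolding V_def W_def .
qed

text \<open>
  The integrated inequality is applied to the bounded sets \<open>E\<close> on which the pointwise one fails.
  The constant \<open>C_const m = 2\<^bsup>m/(m-1)\<^esup>\<close> is the largest value of \<open>(s/t)\<^bsup>m/(m-1)\<^esup>\<close> for \<open>s \<le> 2t\<close>.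
\<close>

lemma weak_dual_solution_powr_le_inverse_op:
  fixes u :: "real \<Rightarrow> 'a::euclidean_space \<Rightarrow> real"
  assumes sol: "weak_dual_solution G m u0 u" and comp: "comparison_principle G m"
    and m: "1 < m" and u0: "integrable lborel u0" "AE x in lborel. 0 \<le> u0 x"
    and G: "AE x in lborel. 0 \<le> G 0 x" and Gm: "G 0 \<in> borel_measurable borel"
  shows "AE t in lborel. 0 < t \<longrightarrow>
    (AE x in lborel. u t x powr m \<le> C_const m / t * inverse_op G (u t) x)"
proof -
  define C where "C = C_const m"
  have C: "0 < C" by (simp add: C_def C_const_def)
  have nonneg: "0 \<le> u t x" if "0 \<le> t" for t x
    using weak_dual_solution_nonneg[OF sol that] .
  have meas: "u t \<in> borel_measurable borel" if "0 \<le> t" for t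
    using weak_dual_solution_integrable[OF sol that] by auto
  have mono: "AE x in lborel. u \<tau> x powr m \<le> C * u t x powr m"
    if \<tau>: "0 < \<tau>" "\<tau> \<le> t" "t \<le> 2 * \<tau>" for \<tau> t
    using weak_dual_solution_monotone[OF sol comp m u0 \<tau>(1,2)]
  proof eventually_elim
    case (elim x)
    have "u \<tau> x powr m \<le> ((t / \<tau>) powr (1 / (m - 1)) * u t x) powr m"
      using elim m nonneg[of \<tau> x] \<tau> by (intro powr_mono2) auto
    also have "\<dots> = (t / \<tau>) powr (m / (m - 1)) * u t x powr m"
      using nonneg[of t x] \<tau> by (simp add: powr_mult powr_powr)
    also have "\<dots> \<le> C * u t x powr m"
      unfolding C_def C_const_def using \<tau> m by (intro mult_right_mono powr_mono2) (auto simp: field_simps)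
    finally show ?case .
  qed
  \<comment> \<open>The exceptional set of the dual identity depends on the final time; integer final times suffice.\<close>
  have "AE \<tau> in lborel. AE \<sigma> in lborel. 0 < \<tau> \<and> \<tau> \<le> \<sigma> \<and> \<sigma> \<le> real (Suc n) \<longrightarrow>
      (\<forall>\<psi> \<psi>'. C1_Linf_test \<tau> \<sigma> \<psi> \<psi>' \<longrightarrow> dual_identity G m u \<tau> \<sigma> \<psi> \<psi>')" for n
    using sol unfolding weak_dual_solution_def
    by (intro AE_lborel_pairD weak_dual_solution_on_dual_identity[of _ G m u0]) auto
  then have "AE \<tau> in lborel. \<forall>n. AE \<sigma> in lborel. 0 < \<tau> \<and> \<tau> \<le> \<sigma> \<and> \<sigma> \<le> real (Suc n) \<longrightarrow>
      (\<forall>\<psi> \<psi>'. C1_Linf_test \<tau> \<sigma> \<psi> \<psi>' \<longrightarrow> dual_identity G m u \<tau> \<sigma> \<psi> \<psi>')"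
    by (simp only: AE_all_countable) blast
  then show ?thesis
  proof eventually_elim
    case (elim \<tau>)
    show ?case
    proof
      assume \<tau>: "0 < \<tau>"
      have "AE \<sigma> in lborel. \<forall>n. 0 < \<tau> \<and> \<tau> \<le> \<sigma> \<and> \<sigma> \<le> real (Suc n) \<longrightarrow>
          (\<forall>\<psi> \<psi>'. C1_Linf_test \<tau> \<sigma> \<psi> \<psi>' \<longrightarrow> dual_identity G m u \<tau> \<sigma> \<psi> \<psi>')"
        using elim unfolding AE_all_countable .
      then have ident: "AE \<sigma> in lborel. \<tau> < \<sigma> \<longrightarrow>
          (\<forall>\<psi> \<psi>'. C1_Linf_test \<tau> \<sigma> \<psi> \<psi>' \<longrightarrow> dual_identity G m u \<tau> \<sigma> \<psi> \<psi>')"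
      proof eventually_elim
        case (elim \<sigma>)
        obtain n where "\<sigma> \<le> real n" using real_arch_simple by blast
        then have "\<sigma> \<le> real (Suc n)" by simp
        with elim \<tau> show ?case by (meson less_imp_le)
      qed
      define D where "D x = u \<tau> x powr m - C / \<tau> * inverse_op G (u \<tau>) x" for x
      have [measurable]: "u \<tau> \<in> borel_measurable borel" "inverse_op G (u \<tau>) \<in> borel_measurable borel"
        using meas[of \<tau>] \<tau> inverse_op_measurable[of G, OF Gm, of "u \<tau>"] by auto
      have [measurable]: "D \<in> borel_measurable borel"
        unfolding D_def by measurable
      have "AE x in lborel. x \<in> ball 0 (real k) \<longrightarrow> D x \<le> 0" for k
      proof -
        define E where "E = ball 0 (real k) \<inter> {x. 0 < D x}"
        have E[measurable]: "E \<in> sets borel"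
          unfolding E_def by (intro sets.Int) auto
        have "bounded E"
          unfolding E_def by (rule bounded_subset[OF bounded_ball]) auto
        with E have test: "C1_Linf_test a b (\<lambda>_. indicator E) (\<lambda>_ _. 0)" for a b
          by (rule C1_Linf_test_indicator)
        have "AE \<sigma> in lborel. \<tau> < \<sigma> \<longrightarrow> dual_identity G m u \<tau> \<sigma> (\<lambda>_. indicator E) (\<lambda>_ _. 0)"
          using ident by eventually_elim (use test in blast)
        note * = integral_powr_le_integral_inverse_op[OF m \<tau> C E nonneg meas G mono[OF \<tau>] this]
        have int: "integrable lborel (\<lambda>x. D x * indicator E x)"
          and D_eq: "(LINT x|lborel. D x * indicator E x) =
            (LINT x|lborel. u \<tau> x powr m * indicator E x) -
            C / \<tau> * (LINT x|lborel. inverse_op G (u \<tau>) x * indicator E x)"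
          using *(1) integrable_mult_right[OF *(2), of "C / \<tau>"]
          by (simp_all add: D_def left_diff_distrib mult.assoc)
        have "\<tau> * (LINT x|lborel. D x * indicator E x) \<le> 0"
          unfolding D_eq using *(3) \<tau> by (simp add: right_diff_distrib)
        then have "(LINT x|lborel. D x * indicator E x) \<le> 0"
          using \<tau> by (simp add: mult_le_0_iff)
        moreover have nn: "AE x in lborel. 0 \<le> D x * indicator E x"
          by (auto simp: E_def indicator_def)
        ultimately have "(LINT x|lborel. D x * indicator E x) = 0"
          using integral_nonneg_AE[OF nn] by simp
        then have "AE x in lborel. D x * indicator E x = 0"
          using integral_nonneg_eq_0_iff_AE[OF int nn] by simp
        then show ?thesis
          by eventually_elim (auto simp: E_def indicator_def split: if_splits)
      qed
      then have "AE x in lborel. \<forall>k. x \<in> ball 0 (real k) \<longrightarrow> D x \<le> 0"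
        by (simp only: AE_all_countable) blast
      then show "AE x in lborel. u \<tau> x powr m \<le> C_const m / \<tau> * inverse_op G (u \<tau>) x"
      proof eventually_elim
        case (elim x)
        obtain k where "norm x < real k" using reals_Archimedean2 by blast
        with elim have "D x \<le> 0" by auto
        then show ?case by (simp add: D_def C_def)
      qed
    qed
  qed
qed

section \<open>The smoothing effect\<close>

lemma locally_integrable_borel_measurable:
  assumes "locally_integrable f"
  shows "f \<in> borel_measurable borel"
proof (rule borel_measurable_LIMSEQ_real)
  show "(\<lambda>n. indicator (cball 0 (real n)) x * f x) \<longlonglongrightarrow> f x" for x
  proof (rule tendsto_eventually)
    obtain k where "norm x \<le> real k" using real_arch_simple by blast
    then show "\<forall>\<^sub>F n in sequentially. indicator (cball 0 (real n)) x * f x = f x"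
      by (intro eventually_sequentiallyI[of k]) (auto simp: indicator_def)
  qed
  show "(\<lambda>x. indicator (cball 0 (real n)) x * f x) \<in> borel_measurable borel" for n
  proof -
    have "integrable lborel (\<lambda>x. indicator (cball 0 (real n)) x * f x)"
      using assms compact_cball[of 0 "real n"]
      by (simp add: locally_integrable_def set_integrable_def)
    from borel_measurable_integrable[OF this] show ?thesis by simp
  qed
qed

text \<open>
  The bounds at the pole \<open>x0\<close> hold at the pole \<open>0\<close> by translation invariance.
\<close>

lemma green_function_kernel_split:
  fixes G :: "'a::euclidean_space \<Rightarrow> 'a \<Rightarrow> real"
  assumes G: "green_function D A G" and b: "green_bounds G x0 K1 K2 \<beta> R"
    and K: "0 < K1" "0 < K2" and R: "0 < R"
  shows "kernel_split (G 0) R (K1 * R powr \<beta>) (K2 * R powr (- (real DIM('a) - \<beta>)))"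
proof
  note G' = G[unfolded green_function_def, rule_format]
  have loc: "locally_integrable (G y)" for y using G' by blast
  show m[measurable]: "G 0 \<in> borel_measurable borel"
    by (rule locally_integrable_borel_measurable[OF loc])
  have pole: "AE x in lborel. 0 \<le> G x0 x \<and> G x0 x = G 0 (x - x0)"
  proof -
    have "AE x in lborel. 0 \<le> G x0 x \<and> G x0 x = G 0 (x - x0) \<and> G x0 x = G 0 (x0 - x)"
      using G' by blast
    then show ?thesis by eventually_elim auto
  qed
  have "AE x in lborel. 0 \<le> G 0 x \<and> G 0 x = G 0 (x - 0) \<and> G 0 x = G 0 (0 - x)"
    using G' by blast
  then show "AE x in lborel. 0 \<le> G 0 x" by eventually_elim auto
  show "0 \<le> K1 * R powr \<beta>" "0 \<le> K2 * R powr (- (real DIM('a) - \<beta>))"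
    using K by auto
  have "set_integrable lborel (cball x0 R) (G x0)"
    using loc[of x0] unfolding locally_integrable_def by auto
  then have "set_integrable lborel (ball x0 R) (G x0)"
    by (rule set_integrable_subset) auto
  then have int: "integrable lborel (\<lambda>x. indicator (ball x0 R) x * G x0 x)"
    by (simp add: set_integrable_def)
  have "(\<integral>\<^sup>+ x. ennreal (G 0 x) * indicator (ball 0 R) x \<partial>lborel) =
      (\<integral>\<^sup>+ x. ennreal (G 0 (x - x0)) * indicator (ball 0 R) (x - x0) \<partial>lborel)"
    by (rule nn_integral_lborel_shift[symmetric])
      (auto intro!: borel_measurable_times_ennreal borel_measurable_indicator)
  also have "\<dots> = (\<integral>\<^sup>+ x. ennreal (indicator (ball x0 R) x * G x0 x) \<partial>lborel)"
  proof (rule nn_integral_cong_AE)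
    show "AE x in lborel. ennreal (G 0 (x - x0)) * indicator (ball 0 R) (x - x0) =
        ennreal (indicator (ball x0 R) x * G x0 x)"
      using pole by eventually_elim (simp add: indicator_def dist_norm norm_minus_commute)
  qed
  also have "\<dots> = ennreal (LINT x:ball x0 R|lborel. G x0 x)"
    unfolding set_lebesgue_integral_def using int pole
    by (subst nn_integral_eq_integral) (auto elim!: eventually_mono)
  also have "\<dots> \<le> ennreal (K1 * R powr \<beta>)"
    using b by (intro ennreal_leI) (simp add: green_bounds_def)
  finally show "(\<integral>\<^sup>+ x. ennreal (G 0 x) * indicator (ball 0 R) x \<partial>lborel) \<le> ennreal (K1 * R powr \<beta>)" .
  have "AE x in lborel. x \<notin> ball x0 R \<longrightarrow> G x0 x \<le> K2 * R powr (- (real DIM('a) - \<beta>))"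
    using b by (simp add: green_bounds_def)
  with pole have "AE x in lborel. x - x0 \<notin> ball 0 R \<longrightarrow>
      G 0 (x - x0) \<le> K2 * R powr (- (real DIM('a) - \<beta>))"
    by eventually_elim (auto simp: dist_norm norm_minus_commute)
  from AE_lborel_shift[OF this, of "- x0"]
  show "AE x in lborel. x \<notin> ball 0 R \<longrightarrow> G 0 x \<le> K2 * R powr (- (real DIM('a) - \<beta>))"
    by simp
qed

text \<open>
  If the integral that defines \<open>inverse_op\<close> diverges, its value is \<open>0\<close> by convention and the inequality
  is trivial.
\<close>

lemma (in kernel_split) inverse_op_le_conv:
  assumes [measurable]: "f \<in> borel_measurable borel" and f: "\<And>x. 0 \<le> f x" and G: "G 0 = g"
  shows "ennreal (inverse_op G f x) \<le> conv f x"
proof (cases "integrable lborel (\<lambda>y. g (y - x) * f y)")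
  case True
  have "AE y in lborel. 0 \<le> g (y - x) * f y"
    using AE_lborel_shift[OF g_nonneg, of x] by eventually_elim (simp add: f)
  from nn_integral_eq_integral[OF True this] show ?thesis
    by (simp add: conv_def inverse_op_def G)
next
  case False
  then show ?thesis
    by (simp add: inverse_op_def G not_integrable_integral_eq)
qed

text \<open>
  For this \<open>R\<close> both \<open>(R\<^sup>\<beta> / t)\<^bsup>m/(m-1)\<^esup>\<close> and \<open>R\<^bsup>-(N-\<beta>)\<^esup> M / t\<close> equal \<open>Q\<^sup>m\<close> with
  \<open>Q = t\<^bsup>-N\<theta>\<^esup> M\<^bsup>\<beta>\<theta>\<^esup>\<close>.
\<close>

lemma optimal_radius:
  fixes N m \<beta> t M K1 K2 C :: real
  assumes "1 < m" "0 < N" "0 < \<beta>" "0 < t" "0 < M" "0 < K1" "0 < K2" "0 < C"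
  defines "\<theta> \<equiv> inverse (\<beta> + N * (m - 1))"
  defines "R \<equiv> (t * M powr (m - 1)) powr \<theta>"
  shows "((C / t * (K1 * R powr \<beta>)) powr (m / (m - 1))
      + m / (m - 1) * (C / t * ((K2 * R powr (- (N - \<beta>))) * M))) powr (1 / m) =
    ((C * K1) powr (m / (m - 1)) + m / (m - 1) * C * K2) powr (1 / m) *
      (t powr (- (N * \<theta>)) * M powr (\<beta> * \<theta>))"
proof -
  define Q where "Q = t powr (- (N * \<theta>)) * M powr (\<beta> * \<theta>)"
  have Q: "0 < Q" using assms by (simp add: Q_def)
  have den: "0 < \<beta> + N * (m - 1)" using assms by (simp add: add_pos_pos)
  have \<theta>: "\<theta> * (\<beta> + N * (m - 1)) = 1" using den by (simp add: \<theta>_def)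
  have R: "0 < R" using assms by (simp add: R_def)
  have lnR: "ln R = \<theta> * (ln t + (m - 1) * ln M)"
    using assms by (simp add: R_def ln_powr ln_mult)
  have lnQ: "ln Q = - (N * \<theta>) * ln t + \<beta> * \<theta> * ln M"
    using assms by (simp add: Q_def ln_powr ln_mult)
  have 1: "(R powr \<beta> / t) powr (m / (m - 1)) = Q powr m"
  proof -
    have "\<beta> * ln R - ln t = \<beta> * ln R - \<theta> * (\<beta> + N * (m - 1)) * ln t"
      by (simp add: \<theta>)
    also have "\<dots> = (m - 1) * ln Q"
      unfolding lnR lnQ by (simp add: algebra_simps)
    finally have "m / (m - 1) * (\<beta> * ln R - ln t) = m * ln Q"
      using assms by simp
    moreover have "ln ((R powr \<beta> / t) powr (m / (m - 1))) = m / (m - 1) * (\<beta> * ln R - ln t)"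
      using R assms by (simp add: ln_powr ln_div)
    moreover have "ln (Q powr m) = m * ln Q" using Q by (simp add: ln_powr)
    ultimately show ?thesis
      using Q R assms by (subst ln_inj_iff[symmetric]) auto
  qed
  have 2: "R powr (- (N - \<beta>)) * M / t = Q powr m"
  proof -
    have "ln (R powr (- (N - \<beta>)) * M / t) = - (N - \<beta>) * ln R + ln M - ln t"
      using R assms by (simp add: ln_powr ln_div ln_mult)
    also have "\<dots> = - (N - \<beta>) * ln R + \<theta> * (\<beta> + N * (m - 1)) * (ln M - ln t)"
      by (simp add: \<theta>)
    also have "\<dots> = m * ln Q"
      unfolding lnR lnQ by (simp add: algebra_simps)
    also have "\<dots> = ln (Q powr m)" using Q by (simp add: ln_powr)
    finally show ?thesis
      using Q R assms by (subst (asm) ln_inj_iff) auto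
  qed
  have "C / t * (K1 * R powr \<beta>) = (C * K1) * (R powr \<beta> / t)" by simp
  then have "(C / t * (K1 * R powr \<beta>)) powr (m / (m - 1)) = (C * K1) powr (m / (m - 1)) * Q powr m"
    by (simp only: powr_mult 1)
  moreover have "m / (m - 1) * (C / t * ((K2 * R powr (- (N - \<beta>))) * M)) = m / (m - 1) * C * K2 * Q powr m"
    unfolding 2[symmetric] by simp
  ultimately have sum: "(C / t * (K1 * R powr \<beta>)) powr (m / (m - 1))
      + m / (m - 1) * (C / t * ((K2 * R powr (- (N - \<beta>))) * M)) =
    ((C * K1) powr (m / (m - 1)) + m / (m - 1) * C * K2) * Q powr m"
    by (simp add: distrib_right)
  have root: "(Q powr m) powr (1 / m) = Q" using assms Q by (simp add: powr_powr)
  show ?thesis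
    unfolding Q_def[symmetric] sum powr_mult[of _ "Q powr m"] root ..
qed

text \<open>
  For \<open>M = 0\<close> the radius degenerates to \<open>0\<close>; then \<open>f\<close> vanishes and no bound on the Green function is
  needed.
\<close>

lemma smoothing_bound:
  fixes G :: "'a::euclidean_space \<Rightarrow> 'a \<Rightarrow> real" and f :: "'a \<Rightarrow> real"
  assumes m: "1 < m" and G: "green_function D A G"
    and K: "0 < K1" "0 < K2" and \<beta>: "0 < \<beta>" and t: "0 < t" and M: "0 \<le> M"
    and [measurable]: "f \<in> borel_measurable borel" and f: "\<And>x. 0 \<le> f x"
    and mass: "Lp_norm 1 f \<le> ennreal M"
    and le: "AE x in lborel. f x powr m \<le> C_const m / t * inverse_op G f x"
    and b: "0 < M \<Longrightarrow> green_bounds G x0 K1 K2 \<beta>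
      ((t * M powr (m - 1)) powr (inverse (\<beta> + real DIM('a) * (m - 1))))"
  shows "Lp_norm \<infinity> f \<le> ennreal (C_tilde m K1 K2 *
    (t powr (- (real DIM('a) * inverse (\<beta> + real DIM('a) * (m - 1)))) *
     M powr (\<beta> * inverse (\<beta> + real DIM('a) * (m - 1)))))"
proof -
  have norm: "Lp_norm \<infinity> f = esssup lborel (\<lambda>x. ennreal (f x))"
    unfolding Lp_norm_infinity using f by simp
  have mass': "(\<integral>\<^sup>+ x. ennreal (f x) \<partial>lborel) \<le> ennreal M"
    using mass f by (simp add: Lp_norm_1)
  show ?thesis
  proof (cases "M = 0")
    case True
    then have "(\<integral>\<^sup>+ x. ennreal (f x) \<partial>lborel) = 0" using mass' by simp
    then have "AE x in lborel. ennreal (f x) = 0"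
      by (subst (asm) nn_integral_0_iff_AE) auto
    then have "AE x in lborel. ennreal (f x) \<le> 0"
      by eventually_elim simp
    then have "Lp_norm \<infinity> f \<le> 0"
      unfolding norm by (intro esssup_I) auto
    then show ?thesis by simp
  next
    case False
    with M have M: "0 < M" by simp
    define \<theta> where "\<theta> = inverse (\<beta> + real DIM('a) * (m - 1))"
    define R where "R = (t * M powr (m - 1)) powr \<theta>"
    have R: "0 < R" using M t by (simp add: R_def)
    have C: "0 < C_const m" by (simp add: C_const_def)
    interpret kernel_split "G 0" R "K1 * R powr \<beta>" "K2 * R powr (- (real DIM('a) - \<beta>))"
      using green_function_kernel_split[OF G b[OF M] K] R unfolding R_def \<theta>_def by blast
    have "AE x in lborel. ennreal (f x powr m) \<le> ennreal (C_const m / t) * conv f x"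
      using le
    proof eventually_elim
      case (elim x)
      then have "ennreal (f x powr m) \<le> ennreal (C_const m / t) * ennreal (inverse_op G f x)"
        using C t by (subst ennreal_mult'[symmetric]) (auto intro: ennreal_leI)
      also have "\<dots> \<le> ennreal (C_const m / t) * conv f x"
        using f by (intro mult_left_mono inverse_op_le_conv) auto
      finally show ?case .
    qed
    then have "Lp_norm \<infinity> f \<le> ennreal (((C_const m / t * (K1 * R powr \<beta>)) powr (m / (m - 1))
        + m / (m - 1) * (C_const m / t * ((K2 * R powr (- (real DIM('a) - \<beta>))) * M))) powr (1 / m))"
      unfolding norm using f M m C t mass' by (intro sup_le_of_powr_le_conv) auto
    also have "((C_const m / t * (K1 * R powr \<beta>)) powr (m / (m - 1))
        + m / (m - 1) * (C_const m / t * ((K2 * R powr (- (real DIM('a) - \<beta>))) * M))) powr (1 / m) =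
      ((C_const m * K1) powr (m / (m - 1)) + m / (m - 1) * C_const m * K2) powr (1 / m) *
        (t powr (- (real DIM('a) * \<theta>)) * M powr (\<beta> * \<theta>))"
      unfolding R_def \<theta>_def using m \<beta> t M K C by (intro optimal_radius) auto
    also have "\<dots> \<le> C_tilde m K1 K2 * (t powr (- (real DIM('a) * \<theta>)) * M powr (\<beta> * \<theta>))"
      unfolding C_tilde_def by (intro mult_right_mono) auto
    finally show ?thesis
      unfolding \<theta>_def by (simp add: ennreal_leI)
  qed
qed

theorem theorem3p3:
  fixes D :: "('a::euclidean_space \<Rightarrow> real) set"
    and A :: "('a \<Rightarrow> real) \<Rightarrow> ('a \<Rightarrow> real)"
    and G :: "'a \<Rightarrow> 'a \<Rightarrow> real"
    and u0 :: "'a \<Rightarrow> real"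
    and u :: "real \<Rightarrow> 'a \<Rightarrow> real"
    and m \<alpha> K1 K2 :: real
    and x0 :: 'a
  assumes "DIM('a) \<ge> 3"
    and "m > 1"
    and "integrable lborel u0"
    and "AE x in lborel. 0 \<le> u0 x"
    and "diffusion_operator D A"
    and "green_function D A G"
    and "comparison_principle G m"
    and "Lp_decay G m"
    and "weak_dual_solution G m u0 u"
    and "0 < \<alpha>" and "\<alpha> < 2"
    and "K1 > 0" and "K2 > 0"
    and "\<And>R. 0 < R \<Longrightarrow> R \<le> 1 \<Longrightarrow> green_bounds G x0 K1 K2 \<alpha> R"
    and "\<And>R. R > 1 \<Longrightarrow> green_bounds G x0 K1 K2 2 R"
  shows "let N = real DIM('a);
             M = enn2real (Lp_norm 1 u0);
             \<theta>\<alpha> = inverse (\<alpha> + N * (m - 1));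
             \<theta>2 = inverse (2 + N * (m - 1))
         in (AE t in lborel. 0 < t \<and> t \<le> M powr (- (m - 1)) \<longrightarrow>
               Lp_norm \<infinity> (u t) \<le>
                 ennreal (C_tilde m K1 K2 * (t powr (- (N * \<theta>\<alpha>)) * M powr (\<alpha> * \<theta>\<alpha>)))) \<and>
            (AE t in lborel. t > M powr (- (m - 1)) \<longrightarrow>
               Lp_norm \<infinity> (u t) \<le>
                 ennreal (C_tilde m K1 K2 * (t powr (- (N * \<theta>2)) * M powr (2 * \<theta>2))))"
proof -
  note m = \<open>m > 1\<close> and u0 = assms(3,4) and G = assms(6) and sol = assms(9)
  define M where "M = enn2real (Lp_norm 1 u0)"
  have M: "0 \<le> M" "Lp_norm 1 u0 = ennreal M"
  proof -
    have "Lp_norm 1 u0 < \<infinity>"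
      unfolding Lp_norm_1 using u0(1) by (simp add: integrable_iff_bounded)
    then show "0 \<le> M" "Lp_norm 1 u0 = ennreal M" by (auto simp: M_def)
  qed
  have G0: "G 0 \<in> borel_measurable borel" "AE x in lborel. 0 \<le> G 0 x"
    using kernel_split.g_measurable[OF green_function_kernel_split[OF G assms(14)[of 1]]]
      kernel_split.g_nonneg[OF green_function_kernel_split[OF G assms(14)[of 1]]] assms(12,13)
    by auto
  have radius: "(t * M powr (m - 1)) powr (inverse (\<beta> + real DIM('a) * (m - 1))) \<le> 1
      \<longleftrightarrow> t \<le> M powr (- (m - 1))"
    if "0 < t" "0 < M" "0 < \<beta>" for t \<beta>
  proof -
    define \<theta> where "\<theta> = inverse (\<beta> + real DIM('a) * (m - 1))"
    have "0 < \<theta>"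
      using that m by (simp add: \<theta>_def add_pos_nonneg)
    then have "(t * M powr (m - 1)) powr \<theta> \<le> 1 \<longleftrightarrow> t * M powr (m - 1) \<le> 1"
    proof (cases "t * M powr (m - 1) \<le> 1")
      case True
      with \<open>0 < \<theta>\<close> that show ?thesis
        using powr_le1[of \<theta> "t * M powr (m - 1)"] by simp
    next
      case False
      with \<open>0 < \<theta>\<close> have "1 powr \<theta> < (t * M powr (m - 1)) powr \<theta>"
        by (intro powr_less_mono2) auto
      with False show ?thesis by (simp only: powr_one_eq_one not_le[symmetric])
    qed
    also have "\<dots> \<longleftrightarrow> t \<le> M powr (- (m - 1))"
      unfolding powr_minus[of M "m - 1"] using that by (simp add: field_simps)
    finally show ?thesis by (simp only: \<theta>_def)
  qed
  have main: "AE t in lborel. 0 < t \<longrightarrow> Lp_norm 1 (u t) \<le> ennreal M \<and>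
      (AE x in lborel. u t x powr m \<le> C_const m / t * inverse_op G (u t) x)"
    using weak_dual_solution_mass_le[OF sol assms(8) u0(1)]
      weak_dual_solution_powr_le_inverse_op[OF sol assms(7) m u0 G0(2,1)]
    by eventually_elim (simp add: M)
  have meas: "u t \<in> borel_measurable borel" if "0 < t" for t
    using weak_dual_solution_integrable[OF sol, of t] that by auto
  note bound = smoothing_bound[OF m G assms(12,13) _ _ M(1) meas weak_dual_solution_nonneg[OF sol]]
  have small: "AE t in lborel. 0 < t \<and> t \<le> M powr (- (m - 1)) \<longrightarrow>
    Lp_norm \<infinity> (u t) \<le> ennreal (C_tilde m K1 K2 *
      (t powr (- (real DIM('a) * inverse (\<alpha> + real DIM('a) * (m - 1)))) *
       M powr (\<alpha> * inverse (\<alpha> + real DIM('a) * (m - 1)))))"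
    using main
  proof eventually_elim
    case (elim t)
    show ?case
      using elim assms(10,14) radius by (intro impI bound[where ?x0.0 = x0]) auto
  qed
  have large: "AE t in lborel. t > M powr (- (m - 1)) \<longrightarrow>
    Lp_norm \<infinity> (u t) \<le> ennreal (C_tilde m K1 K2 *
      (t powr (- (real DIM('a) * inverse (2 + real DIM('a) * (m - 1)))) *
       M powr (2 * inverse (2 + real DIM('a) * (m - 1)))))"
    using main
  proof eventually_elim
    case (elim t)
    show ?case
    proof
      assume *: "t > M powr (- (m - 1))"
      then have t: "0 < t" by (rule le_less_trans[OF powr_ge_zero])
      have "1 < (t * M powr (m - 1)) powr (inverse (2 + real DIM('a) * (m - 1)))" if "0 < M"
        using radius[OF t that, of 2] * by simp
      then show "Lp_norm \<infinity> (u t) \<le> ennreal (C_tilde m K1 K2 *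
          (t powr (- (real DIM('a) * inverse (2 + real DIM('a) * (m - 1)))) *
           M powr (2 * inverse (2 + real DIM('a) * (m - 1)))))"
        using elim t assms(15) by (intro bound[where ?x0.0 = x0]) auto
    qed
  qed
  show ?thesis
    using small large unfolding Let_def M_def by (rule conjI)
qed

end
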